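(* Let $R$ be a non-discrete irreducible, continuous ring, let $S\subseteq Z(R)[X]$ with $\emptyset\ne S\ne\{0\}$, and let $c\in V_{Z(R)}(S)$, i.e., $c\in Z(R)$ and $p(c)=0$ for all $p\in S$. Then the pointed metric space $(V_R(S),d_R,c)$ is star-shaped; that is, for every $x\in V_R(S)$ there exists a geodesic in $(V_R(S),d_R)$ from $c$ to $x$.
   Context: All rings are unital. A ring $R$ is regular if for every $a \in R$ there is $b \in R$ with $aba=a$. For a regular ring $R$, the set $L(R)=\{aR : a\in R\}$, ordered by inclusion, is a complemented modular lattice. A continuous ring is a regular ring $R$ such that the lattice $L(R)$ is complete and satisfies $I\wedge\bigvee C=\bigvee\{I\wedge J : J\in C\}$ and $I\vee\bigwedge C=\bigwedge\{I\vee J : J\in C\}$ for every chain $C\subseteq L(R)$ and every $I\in L(R)$. A ring is irreducible if it is non-zero and not isomorphic to a direct product of two non-zero rings. A rank function on a regular ring $R$ is a map $\rho\colon R\to[0,1]$ with $\rho(1)=1$, $\rho(ab)\le\min\{\rho(a),\rho(b)\}$ for all $a,b \in R$, $\rho(e+f)=\rho(e)+\rho(f)$ for any idempotents $e,f$ with $ef=fe=0$, and $\rho(a)=0$ only if $a=0$. Every irreducible, continuous ring $R$ has a unique rank function, denoted $\mathrm{rk}_R$; the rank metric is $d_R(a,b)=\mathrm{rk}_R(a-b)$, and the topology it generates is the rank topology. $R$ is non-discrete if its rank topology is not discrete. The center $Z(R)$ is a field. For $S\subseteq Z(R)[X]$ and a unital $Z(R)$-algebra $A$, $V_A(S)=\{a\in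 A : p(a)=0 \text{ for all } p\in S\}$. A geodesic in a metric space $(X,d)$ from $x$ to $y$ is an isometric map $\varphi\colon[0,d(x,y)]\to X$ with $\varphi(0)=x$ and $\varphi(d(x,y))=y$. *)

theory Defs
  imports
    "HOL-Algebra.Chinese_Remainder"
    "HOL-Algebra.Complete_Lattice"
    "HOL-Algebra.Polynomials"
    "HOL-Analysis.Abstract_Metric_Spaces"
begin

section \<open>Continuous rings\<close>

locale regular_ring = ring +
  assumes regular: "a \<in> carrier R \<Longrightarrow> \<exists>b\<in>carrier R. a \<otimes> b \<otimes> a = a"

definition principal_right_ideal :: "('a, 'b) ring_scheme \<Rightarrow> 'a \<Rightarrow> 'a set" where
  "principal_right_ideal R a = (\<lambda>r. a \<otimes>\<^bsub>R\<^esub> r) ` carrier R"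

definition ring_lattice :: "('a, 'b) ring_scheme \<Rightarrow> 'a set gorder" where
  "ring_lattice R =
     \<lparr>carrier = principal_right_ideal R ` carrier R, eq = (=), le = (\<subseteq>)\<rparr>"

text \<open>The joins and meets below are those of the poset of principal right ideals. In particular
  infinite joins and meets are in general neither sums nor intersections of ideals.\<close>

locale continuous_ring = regular_ring +
  assumes complete: "complete_lattice (ring_lattice R)"
  and meet_continuous:
    "\<lbrakk>subset.chain (carrier (ring_lattice R)) C; I \<in> carrier (ring_lattice R)\<rbrakk> \<Longrightarrow>
       I \<sqinter>\<^bsub>ring_lattice R\<^esub> (\<Squnion>\<^bsub>ring_lattice R\<^esub> C)
         = \<Squnion>\<^bsub>ring_lattice R\<^esub> ((\<lambda>J. I \<sqinter>\<^bsub>ring_lattice R\<^esub> J) ` C)"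
  and join_continuous:
    "\<lbrakk>subset.chain (carrier (ring_lattice R)) C; I \<in> carrier (ring_lattice R)\<rbrakk> \<Longrightarrow>
       I \<squnion>\<^bsub>ring_lattice R\<^esub> (\<Sqinter>\<^bsub>ring_lattice R\<^esub> C)
         = \<Sqinter>\<^bsub>ring_lattice R\<^esub> ((\<lambda>J. I \<squnion>\<^bsub>ring_lattice R\<^esub> J) ` C)"

text \<open>Taking the factors over the element type of \<open>R\<close> is no restriction: if \<open>R\<close> is isomorphic to
  \<open>S \<times> T\<close>, then \<open>S\<close> and \<open>T\<close> are isomorphic to rings carried by the subsets of \<open>R\<close>
  corresponding to \<open>S \<times> {0}\<close> and \<open>{0} \<times> T\<close>.\<close>

definition irreducible_ring :: "('a, 'b) ring_scheme \<Rightarrow> bool" where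
  "irreducible_ring R \<longleftrightarrow> carrier R \<noteq> {\<zero>\<^bsub>R\<^esub>} \<and>
     \<not> (\<exists>(S :: 'a ring) (T :: 'a ring). ring S \<and> ring T \<and>
          carrier S \<noteq> {\<zero>\<^bsub>S\<^esub>} \<and> carrier T \<noteq> {\<zero>\<^bsub>T\<^esub>} \<and> R \<simeq> RDirProd S T)"

definition ring_center :: "('a, 'b) ring_scheme \<Rightarrow> 'a set" where
  "ring_center R = {z \<in> carrier R. \<forall>a\<in>carrier R. z \<otimes>\<^bsub>R\<^esub> a = a \<otimes>\<^bsub>R\<^esub> z}"


section \<open>Rank functions and the rank metric\<close>

definition rank_function :: "('a, 'b) ring_scheme \<Rightarrow> ('a \<Rightarrow> real) \<Rightarrow> bool" where
  "rank_function R \<rho> \<longleftrightarrow>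
     \<rho> \<in> carrier R \<rightarrow> {0..1} \<and>
     \<rho> \<one>\<^bsub>R\<^esub> = 1 \<and>
     (\<forall>a\<in>carrier R. \<forall>b\<in>carrier R. \<rho> (a \<otimes>\<^bsub>R\<^esub> b) \<le> min (\<rho> a) (\<rho> b)) \<and>
     (\<forall>e\<in>carrier R. \<forall>f\<in>carrier R.
        e \<otimes>\<^bsub>R\<^esub> e = e \<and> f \<otimes>\<^bsub>R\<^esub> f = f \<and> e \<otimes>\<^bsub>R\<^esub> f = \<zero>\<^bsub>R\<^esub> \<and> f \<otimes>\<^bsub>R\<^esub> e = \<zero>\<^bsub>R\<^esub>
          \<longrightarrow> \<rho> (e \<oplus>\<^bsub>R\<^esub> f) = \<rho> e + \<rho> f) \<and>
     (\<forall>a\<in>carrier R. \<rho> a = 0 \<longrightarrow> a = \<zero>\<^bsub>R\<^esub>)"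

text \<open>The value \<open>0\<close> outside the carrier is a convention: the locale \<open>Metric_space\<close> requires
  nonnegativity and symmetry of the distance on the whole type.\<close>

definition rank_dist :: "('a, 'b) ring_scheme \<Rightarrow> ('a \<Rightarrow> real) \<Rightarrow> 'a \<Rightarrow> 'a \<Rightarrow> real" where
  "rank_dist R \<rho> a b =
     (if a \<in> carrier R \<and> b \<in> carrier R then \<rho> (a \<ominus>\<^bsub>R\<^esub> b) else 0)"

definition rank_topology :: "('a, 'b) ring_scheme \<Rightarrow> ('a \<Rightarrow> real) \<Rightarrow> 'a topology" where
  "rank_topology R \<rho> = Metric_space.mtopology (carrier R) (rank_dist R \<rho>)"


section \<open>Zero sets of polynomials\<close>

text \<open>\<open>A\<close> is a subset of \<open>R\<close>, such as \<open>R\<close> itself or its center.\<close>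

definition poly_zeros :: "('a, 'b) ring_scheme \<Rightarrow> 'a set \<Rightarrow> 'a list set \<Rightarrow> 'a set" where
  "poly_zeros R A S = {a \<in> A. \<forall>p\<in>S. ring.eval R p a = \<zero>\<^bsub>R\<^esub>}"


section \<open>Geodesics\<close>

definition geodesic ::
    "'a set \<Rightarrow> ('a \<Rightarrow> 'a \<Rightarrow> real) \<Rightarrow> 'a \<Rightarrow> 'a \<Rightarrow> (real \<Rightarrow> 'a) \<Rightarrow> bool" where
  "geodesic M d x y \<phi> \<longleftrightarrow>
     \<phi> \<in> {0..d x y} \<rightarrow> M \<and>
     (\<forall>s\<in>{0..d x y}. \<forall>t\<in>{0..d x y}. d (\<phi> s) (\<phi> t) = dist s t) \<and>
     \<phi> 0 = x \<and> \<phi> (d x y) = y"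

definition star_shaped :: "'a set \<Rightarrow> ('a \<Rightarrow> 'a \<Rightarrow> real) \<Rightarrow> 'a \<Rightarrow> bool" where
  "star_shaped M d c \<longleftrightarrow>
     Metric_space M d \<and> c \<in> M \<and> (\<forall>x\<in>M. \<exists>\<phi>. geodesic M d c x \<phi>)"

end

theory Submission
  imports Defs
begin

text \<open>Write \<open>x = c + b\<close>. If \<open>e\<close> is an idempotent whose image \<open>eR\<close> is invariant under \<open>x\<close>, then every
  \<open>p \<in> S\<close> vanishes at \<open>c + be\<close>, because \<open>p(c + be) = p(x)e + p(c)(1 - e)\<close>. For invariant idempotents
  \<open>e \<le> f\<close> above a projection onto the kernel of \<open>b\<close>, moreover, \<open>rk (bf - be) = rk f - rk e\<close>. So
  \<open>t \<mapsto> c + be\<^sub>t\<close> is a geodesic as soon as the \<open>e\<^sub>t\<close> form a chain of such idempotents in which the rank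
  takes every possible value once. In a maximal chain the rank has no jump: by algebraicity, \<open>x\<close> and
  an element of small rank generate an invariant right ideal of small rank. Limits exist in the chain
  by completeness of the lattice, and the rank passes to them because it is continuous along chains
  of principal right ideals. That continuity is von Neumann's theorem; it follows from the
  comparability of right ideals, which in turn comes from irreducibility and Zorn's lemma.\<close>

text \<open>A rank function is only assumed to be additive on orthogonal idempotents, so a limit in
  the lattice says nothing by itself about the rank of that limit. This is the main obstacle, and
  the comparison of right ideals is there to overcome it. The chain consists of idempotents rather
  than right ideals because \<open>c + be\<close> depends on the kernel of \<open>e\<close> as well
  as on its image: only if images grow while kernels shrink is \<open>f - e\<close> an idempotent of
  rank \<open>rk f - rk e\<close>. Invariance under \<open>x\<close> restricts the images only,
  which leaves the kernels free to be adjusted when an idempotent is inserted into a gap. On the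
  kernel of \<open>b\<close>, where the chain starts, \<open>x\<close> acts as the scalar
  \<open>c\<close>; all later increments lie in a complement of this kernel, on which
  \<open>b\<close> preserves rank. Centrality of the coefficients makes the sum of the right ideals
  generated by \<open>x^k v\<close>, for \<open>k\<close> below the degree, closed under
  \<open>x\<close>; its dimension is at most the degree times \<open>rk v\<close>, and
  non-discreteness makes \<open>rk v\<close> small.\<close>

no_notation Sum_Type.Plus (infixr \<open><+>\<close> 65)

section \<open>Principal right ideals of a regular ring\<close>

abbreviation (in ring) pri :: "'a \<Rightarrow> 'a set" where
  "pri \<equiv> principal_right_ideal R"

abbreviation (in ring) pris :: "'a set set" where
  "pris \<equiv> carrier (ring_lattice R)"

context ring
begin

lemma pris_eq: "pris = pri ` carrier R"
  by (simp add: ring_lattice_def)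

lemma pri_in_pris [simp]: "a \<in> carrier R \<Longrightarrow> pri a \<in> pris"
  by (simp add: pris_eq)

lemma pri_mult_mem: "r \<in> carrier R \<Longrightarrow> a \<otimes> r \<in> pri a"
  by (auto simp: principal_right_ideal_def)

lemma generator_mem_pri: "a \<in> carrier R \<Longrightarrow> a \<in> pri a"
  using pri_mult_mem[of \<one> a] by simp

lemma pris_carrier: "I \<in> pris \<Longrightarrow> I \<subseteq> carrier R"
  by (auto simp: pris_eq principal_right_ideal_def)

lemma pris_mem_carrier: "I \<in> pris \<Longrightarrow> x \<in> I \<Longrightarrow> x \<in> carrier R"
  using pris_carrier by blast

lemma pris_zero: "I \<in> pris \<Longrightarrow> \<zero> \<in> I"
proof -
  assume "I \<in> pris"
  then obtain a where "a \<in> carrier R" "I = pri a" unfolding pris_eq by blast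
  then show "\<zero> \<in> I" using pri_mult_mem[OF zero_closed, of a] by simp
qed

lemma pris_add: "I \<in> pris \<Longrightarrow> x \<in> I \<Longrightarrow> y \<in> I \<Longrightarrow> x \<oplus> y \<in> I"
  by (auto simp: pris_eq principal_right_ideal_def r_distr[symmetric])

lemma pris_mult: "I \<in> pris \<Longrightarrow> x \<in> I \<Longrightarrow> r \<in> carrier R \<Longrightarrow> x \<otimes> r \<in> I"
  by (auto simp: pris_eq principal_right_ideal_def m_assoc)

lemma pris_neg: "I \<in> pris \<Longrightarrow> x \<in> I \<Longrightarrow> \<ominus> x \<in> I"
  using pris_mult[of I x "\<ominus> \<one>"] pris_mem_carrier[of I x] by (simp add: r_minus)

lemma pris_diff: "I \<in> pris \<Longrightarrow> x \<in> I \<Longrightarrow> y \<in> I \<Longrightarrow> x \<ominus> y \<in> I"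
  by (simp add: minus_eq pris_add pris_neg)

lemma pri_subset_iff: "I \<in> pris \<Longrightarrow> a \<in> carrier R \<Longrightarrow> pri a \<subseteq> I \<longleftrightarrow> a \<in> I"
  using generator_mem_pri pris_mult by (auto simp: principal_right_ideal_def)

lemma pri_one [simp]: "pri \<one> = carrier R"
  by (auto simp: principal_right_ideal_def)

lemma carrier_in_pris: "carrier R \<in> pris"
  using pri_in_pris[of \<one>] by simp

lemma zero_in_pris: "{\<zero>} \<in> pris"
proof -
  have "pri \<zero> = {\<zero>}" by (auto simp: principal_right_ideal_def)
  then show ?thesis using pri_in_pris[of \<zero>] by simp
qed

lemma mem_pri_idem:
  assumes "e \<in> carrier R" "e \<otimes> e = e"
  shows "x \<in> pri e \<longleftrightarrow> x \<in> carrier R \<and> e \<otimes> x = x"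
proof
  assume "x \<in> pri e"
  then show "x \<in> carrier R \<and> e \<otimes> x = x"
    using assms by (auto simp: principal_right_ideal_def m_assoc[symmetric])
next
  assume "x \<in> carrier R \<and> e \<otimes> x = x"
  then show "x \<in> pri e" using pri_mult_mem[of x e] by simp
qed

lemma mem_set_add: "x \<in> I <+> J \<longleftrightarrow> (\<exists>i\<in>I. \<exists>j\<in>J. x = i \<oplus> j)"
  by (auto simp: set_add_def')

lemma set_add_subset: 
  "K \<in> pris \<Longrightarrow> I \<subseteq> K \<Longrightarrow> J \<subseteq> K \<Longrightarrow> I <+> J \<subseteq> K"
  by (auto simp: mem_set_add intro!: pris_add)

lemma subset_set_add1: "I \<in> pris \<Longrightarrow> J \<in> pris \<Longrightarrow> I \<subseteq> I <+> J"
  by (force simp: mem_set_add dest: pris_zero pris_mem_carrier)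

lemma subset_set_add2: "I \<in> pris \<Longrightarrow> J \<in> pris \<Longrightarrow> J \<subseteq> I <+> J"
  by (force simp: mem_set_add dest: pris_zero pris_mem_carrier)

lemma set_add_commute: "I \<in> pris \<Longrightarrow> J \<in> pris \<Longrightarrow> I <+> J = J <+> I"
proof -
  have "A <+> B \<subseteq> B <+> A" if "A \<in> pris" "B \<in> pris" for A B
  proof
    fix x assume "x \<in> A <+> B"
    then obtain a b where ab: "a \<in> A" "b \<in> B" "x = a \<oplus> b" unfolding mem_set_add by blast
    then have "x = b \<oplus> a" using that pris_mem_carrier by (simp add: a_comm)
    then show "x \<in> B <+> A" using ab unfolding mem_set_add by blast
  qed
  then show "I \<in> pris \<Longrightarrow> J \<in> pris \<Longrightarrow> I <+> J = J <+> I" by blast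
qed

lemma set_add_mono: "I \<subseteq> I' \<Longrightarrow> J \<subseteq> J' \<Longrightarrow> I <+> J \<subseteq> I' <+> J'"
  unfolding set_add_def' by blast

lemma diff_cancel:
  assumes "x \<in> carrier R" "y \<in> carrier R"
  shows "(x \<oplus> y) \<ominus> x = y" "(x \<oplus> y) \<ominus> y = x"
  using assms by (metis add.inv_solve_right' a_comm minus_eq a_closed)+

lemma idem_compl:
  assumes "e \<in> carrier R" "e \<otimes> e = e"
  shows "(\<one> \<ominus> e) \<otimes> (\<one> \<ominus> e) = \<one> \<ominus> e" "e \<otimes> (\<one> \<ominus> e) = \<zero>" "(\<one> \<ominus> e) \<otimes> e = \<zero>"
  using assms by (auto simp: ring_simprules)

lemma diff_eq_zero: "x \<in> carrier R \<Longrightarrow> y \<in> carrier R \<Longrightarrow> x \<ominus> y = \<zero> \<longleftrightarrow> x = y"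
  by (metis minus_closed r_right_minus_eq)

end

section \<open>Intersections, sums and relative complements of principal right ideals\<close>

context regular_ring
begin

text \<open>If \<open>aba = a\<close>, then \<open>ab\<close> is idempotent, and \<open>a\<close>
  and \<open>ab\<close> are right multiples of each other.\<close>

lemma pris_idem:
  assumes "I \<in> pris"
  obtains e where "e \<in> carrier R" "e \<otimes> e = e" "I = pri e"
proof -
  obtain a where a: "a \<in> carrier R" "I = pri a" using assms by (auto simp: pris_eq)
  obtain b where b: "b \<in> carrier R" "a \<otimes> b \<otimes> a = a" using regular a by blast
  have "(a \<otimes> b) \<otimes> (a \<otimes> b) = a \<otimes> b" using a b by (simp add: m_assoc[symmetric])
  moreover have "I = pri (a \<otimes> b)"
  proof
    show "I \<subseteq> pri (a \<otimes> b)" 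
      using a b pri_mult_mem[of a "a \<otimes> b"] by (simp add: pri_subset_iff)
    show "pri (a \<otimes> b) \<subseteq> I"
      using a b pri_mult_mem[of b a] by (simp add: pri_subset_iff)
  qed
  ultimately show ?thesis using that a b by blast
qed

text \<open>If \<open>uvu = u\<close>, then \<open>1 - vu\<close> is a projection onto the kernel of
  left multiplication by \<open>u\<close>.\<close>

lemma annihilator_in_pris:
  assumes u: "u \<in> carrier R"
  shows "{x \<in> carrier R. u \<otimes> x = \<zero>} \<in> pris"
proof -
  obtain v where v: "v \<in> carrier R" "u \<otimes> v \<otimes> u = u" using regular u by blast
  have "pri (\<one> \<ominus> v \<otimes> u) = {x \<in> carrier R. u \<otimes> x = \<zero>}"
  proof (intro Set.set_eqI iffI)
    fix x assume "x \<in> pri (\<one> \<ominus> v \<otimes> u)"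
    then obtain r where r: "r \<in> carrier R" "x = (\<one> \<ominus> v \<otimes> u) \<otimes> r"
      by (auto simp: principal_right_ideal_def)
    have "u \<otimes> (\<one> \<ominus> v \<otimes> u) = \<zero>"
      using u v by (simp add: minus_eq r_distr r_minus m_assoc[symmetric] r_neg)
    then show "x \<in> {x \<in> carrier R. u \<otimes> x = \<zero>}" using r u v by (simp add: m_assoc[symmetric])
  next
    fix x assume x: "x \<in> {x \<in> carrier R. u \<otimes> x = \<zero>}"
    then have "x = (\<one> \<ominus> v \<otimes> u) \<otimes> x" using u v by (simp add: minus_eq l_distr l_minus m_assoc)
    then show "x \<in> pri (\<one> \<ominus> v \<otimes> u)" using pri_mult_mem[of x "\<one> \<ominus> v \<otimes> u"] x by simp
  qed
  then show ?thesis using pri_in_pris[of "\<one> \<ominus> v \<otimes> u"] u v by simp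
qed

text \<open>An element of \<open>fR\<close> lies in \<open>eR\<close> exactly when
  \<open>1 - e\<close> annihilates it, so the intersection is the image under \<open>f\<close> of
  the annihilator of \<open>(1 - e)f\<close>.\<close>

lemma pris_Int:
  assumes "I \<in> pris" "J \<in> pris" shows "I \<inter> J \<in> pris"
proof -
  obtain e where e: "e \<in> carrier R" "e \<otimes> e = e" "I = pri e" using pris_idem assms by blast
  obtain f where f: "f \<in> carrier R" "f \<otimes> f = f" "J = pri f" using pris_idem assms by blast
  define u where "u = (\<one> \<ominus> e) \<otimes> f"
  have u: "u \<in> carrier R" using e f by (simp add: u_def)
  obtain w where w: "w \<in> carrier R" "{x \<in> carrier R. u \<otimes> x = \<zero>} = pri w"
    using annihilator_in_pris[OF u] by (auto simp: pris_eq)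
  have uw: "u \<otimes> w = \<zero>" using generator_mem_pri[of w] w by blast
  have "I \<inter> J = pri (f \<otimes> w)"
  proof (intro Set.set_eqI iffI)
    fix x assume "x \<in> I \<inter> J"
    then have x: "x \<in> carrier R" "e \<otimes> x = x" "f \<otimes> x = x" using e f by (auto simp: mem_pri_idem)
    have "u \<otimes> x = \<zero>"
      using x e f by (simp add: u_def m_assoc minus_eq l_distr l_minus r_neg)
    then have "x \<in> pri w" using w x by blast
    then obtain r where r: "r \<in> carrier R" "x = w \<otimes> r" by (auto simp: principal_right_ideal_def)
    then have "x = f \<otimes> w \<otimes> r" using x(3) w f by (simp add: m_assoc)
    then show "x \<in> pri (f \<otimes> w)" using pri_mult_mem r by simp
  next
    fix x assume "x \<in> pri (f \<otimes> w)"
    then obtain r where r: "r \<in> carrier R" "x = f \<otimes> w \<otimes> r" by (auto simp: principal_right_ideal_def)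
    have fx: "f \<otimes> x = x" using r f w by (simp add: m_assoc[symmetric])
    have "(\<one> \<ominus> e) \<otimes> x = u \<otimes> w \<otimes> r" using r e f w by (simp add: u_def m_assoc)
    then have "(\<one> \<ominus> e) \<otimes> x = \<zero>" using uw r by simp
    then have "x \<ominus> e \<otimes> x = \<zero>" using r f w e by (simp add: minus_eq l_distr l_minus)
    then have "x = e \<otimes> x" using r f w e by (simp add: diff_eq_zero)
    then show "x \<in> I \<inter> J" using fx r e f w by (simp add: mem_pri_idem)
  qed
  then show ?thesis using f w by simp
qed

text \<open>Modulo \<open>eR\<close>, the generator \<open>b\<close> may be replaced by
  \<open>(1 - e)b\<close>. An idempotent \<open>g\<close> generating the same ideal as
  \<open>(1 - e)b\<close> satisfies \<open>eg = 0\<close>; passing to \<open>h = g(1 - e)\<close>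
  keeps the ideal and also gives \<open>he = 0\<close>, so that \<open>e + h\<close> generates the
  sum.\<close>

lemma pris_set_add:
  assumes "I \<in> pris" "J \<in> pris" shows "I <+> J \<in> pris"
proof -
  obtain e where e: "e \<in> carrier R" "e \<otimes> e = e" "I = pri e" using pris_idem assms by blast
  obtain b where b: "b \<in> carrier R" "J = pri b" using assms by (auto simp: pris_eq)
  have "pri ((\<one> \<ominus> e) \<otimes> b) \<in> pris" using e b by simp
  then obtain g where g: "g \<in> carrier R" "g \<otimes> g = g" "pri ((\<one> \<ominus> e) \<otimes> b) = pri g"
    using pris_idem by blast
  have g_in: "g \<in> pri ((\<one> \<ominus> e) \<otimes> b)" using g generator_mem_pri by blast
  then obtain r where r: "r \<in> carrier R" "g = (\<one> \<ominus> e) \<otimes> b \<otimes> r"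
    by (auto simp: principal_right_ideal_def)
  have eg: "e \<otimes> g = \<zero>"
    using r b e idem_compl[OF e(1,2)] by (simp add: m_assoc[symmetric])
  have gb: "g \<otimes> ((\<one> \<ominus> e) \<otimes> b) = (\<one> \<ominus> e) \<otimes> b"
    using g b e generator_mem_pri[of "(\<one> \<ominus> e) \<otimes> b"] mem_pri_idem[of g] by simp
  define h where "h = g \<otimes> (\<one> \<ominus> e)"
  have h: "h \<in> carrier R" using g e by (simp add: h_def)
  have hg: "h \<otimes> g = g" 
    using g e eg by (simp add: h_def m_assoc minus_eq l_distr l_minus)
  have eh: "e \<otimes> h = \<zero>" using eg g e by (simp add: h_def m_assoc[symmetric])
  have he: "h \<otimes> e = \<zero>" using g e idem_compl[OF e(1,2)] by (simp add: h_def m_assoc)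
  have hh: "h \<otimes> h = h" using hg g e h by (simp add: h_def m_assoc[symmetric])
  have "I <+> J = pri (e \<oplus> h)"
  proof
    have ehI: "(e \<oplus> h) \<otimes> x = x" if "x \<in> pri e" for x
    proof -
      have x: "x \<in> carrier R" "e \<otimes> x = x" using that e by (auto simp: mem_pri_idem)
      have "h \<otimes> x = h \<otimes> (e \<otimes> x)" using x by simp
      also have "\<dots> = \<zero>" using he x(1) h e(1) by (simp only: m_assoc[symmetric] l_null)
      finally show ?thesis using x e h by (simp add: l_distr)
    qed
    have I: "pri e \<subseteq> pri (e \<oplus> h)"
      using ehI pri_mult_mem[of _ "e \<oplus> h"] e h by (metis subsetI mem_pri_idem)
    have "b = e \<otimes> b \<oplus> h \<otimes> ((\<one> \<ominus> e) \<otimes> b)"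
    proof -
      have "h \<otimes> ((\<one> \<ominus> e) \<otimes> b) = h \<otimes> g \<otimes> ((\<one> \<ominus> e) \<otimes> b)" using gb g h e b by (simp add: m_assoc)
      also have "\<dots> = (\<one> \<ominus> e) \<otimes> b" using hg gb by simp
      finally show ?thesis using e b by (simp add: ring_simprules)
    qed
    moreover have "h \<otimes> ((\<one> \<ominus> e) \<otimes> b) = (e \<oplus> h) \<otimes> (h \<otimes> ((\<one> \<ominus> e) \<otimes> b))"
      using eh hh e h b by (simp add: l_distr m_assoc[symmetric])
    moreover have "e \<otimes> b \<in> pri (e \<oplus> h)" using I e b pri_mult_mem[of b e] by blast
    moreover have "(e \<oplus> h) \<otimes> (h \<otimes> ((\<one> \<ominus> e) \<otimes> b)) \<in> pri (e \<oplus> h)"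
      using e h b by (intro pri_mult_mem) simp
    ultimately have "b \<in> pri (e \<oplus> h)" using pris_add[of "pri (e \<oplus> h)"] e h by (metis a_closed pri_in_pris)
    then have J: "J \<subseteq> pri (e \<oplus> h)" using b e h by (simp add: pri_subset_iff)
    show "I <+> J \<subseteq> pri (e \<oplus> h)"
      using I J e h by (intro set_add_subset) auto
    show "pri (e \<oplus> h) \<subseteq> I <+> J"
    proof
      fix x assume "x \<in> pri (e \<oplus> h)"
      then obtain s where s: "s \<in> carrier R" "x = (e \<oplus> h) \<otimes> s" by (auto simp: principal_right_ideal_def)
      \<comment> \<open>With this \<open>t\<close>, \<open>hs = (1 - e)bt\<close> is the element
        \<open>bt\<close> of \<open>J\<close> minus the element \<open>e(bt)\<close> of
        \<open>I\<close>.\<close>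
      define t where "t = r \<otimes> (\<one> \<ominus> e) \<otimes> s"
      have t: "t \<in> carrier R" using r e s by (simp add: t_def)
      have "h \<otimes> s = (\<one> \<ominus> e) \<otimes> b \<otimes> t"
        using r e b s by (simp add: h_def t_def m_assoc)
      also have "\<dots> = b \<otimes> t \<ominus> e \<otimes> (b \<otimes> t)" using e b t by (simp add: ring_simprules)
      finally have "x = (e \<otimes> s \<ominus> e \<otimes> (b \<otimes> t)) \<oplus> b \<otimes> t"
        using s e h b t by (simp add: l_distr minus_eq a_ac)
      moreover have "e \<otimes> s \<ominus> e \<otimes> (b \<otimes> t) \<in> I"
        using e b s t by (auto intro!: pris_diff pri_mult_mem)
      moreover have "b \<otimes> t \<in> J" using b t by (simp add: pri_mult_mem)
      ultimately show "x \<in> I <+> J" by (auto simp: mem_set_add)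
    qed
  qed
  then show ?thesis using e h by simp
qed

text \<open>The complement is the part of \<open>K\<close> killed by a projection \<open>e\<close>
  onto \<open>I\<close>, by the splitting \<open>x = ex + (x - ex)\<close>.\<close>

lemma pris_complement:
  assumes "I \<in> pris" "K \<in> pris" "I \<subseteq> K"
  obtains J where "J \<in> pris" "J \<subseteq> K" "I \<inter> J = {\<zero>}" "I <+> J = K"
proof -
  obtain e where e: "e \<in> carrier R" "e \<otimes> e = e" "I = pri e" using pris_idem assms by blast
  define J where "J = K \<inter> {x \<in> carrier R. e \<otimes> x = \<zero>}"
  have J: "J \<in> pris" using assms e by (simp add: J_def pris_Int annihilator_in_pris)
  have "I \<inter> J = {\<zero>}"
    using e J assms pris_zero[of I] pris_zero[of J] by (auto simp: J_def mem_pri_idem)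
  moreover have "I <+> J = K"
  proof
    show "I <+> J \<subseteq> K" using assms by (intro set_add_subset) (auto simp: J_def)
    show "K \<subseteq> I <+> J"
    proof
      fix x assume x: "x \<in> K"
      then have xc: "x \<in> carrier R" using assms pris_mem_carrier by blast
      have ex: "e \<otimes> x \<in> I" using e xc by (simp add: pri_mult_mem)
      then have "x \<ominus> e \<otimes> x \<in> K" using x assms by (blast intro: pris_diff)
      moreover have "e \<otimes> (x \<ominus> e \<otimes> x) = \<zero>"
        using e xc by (simp add: minus_eq r_distr r_minus m_assoc[symmetric] r_neg)
      ultimately have "x \<ominus> e \<otimes> x \<in> J" using e xc by (simp add: J_def)
      moreover have "x = e \<otimes> x \<oplus> (x \<ominus> e \<otimes> x)" using e xc by (simp add: ring_simprules)
      ultimately show "x \<in> I <+> J" using ex by (auto simp: mem_set_add)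
    qed
  qed
  ultimately show ?thesis using that J by (auto simp: J_def)
qed

text \<open>Splitting the generator of \<open>I <+> J\<close> along the decomposition yields orthogonal idempotents.\<close>

lemma disjoint_orthogonal_idems:
  assumes "I \<in> pris" "J \<in> pris" "I \<inter> J = {\<zero>}" "k \<in> carrier R" "k \<otimes> k = k" "I <+> J = pri k"
  obtains e f where "e \<in> carrier R" "f \<in> carrier R" "e \<otimes> e = e" "f \<otimes> f = f"
    "e \<otimes> f = \<zero>" "f \<otimes> e = \<zero>" "I = pri e" "J = pri f" "k = e \<oplus> f"
proof -
  have "k \<in> I <+> J" using assms generator_mem_pri by simp
  then obtain e f where ef: "e \<in> I" "f \<in> J" "k = e \<oplus> f" by (auto simp: mem_set_add)
  have c: "e \<in> carrier R" "f \<in> carrier R" using ef assms pris_mem_carrier by auto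
  have kx: "k \<otimes> x = x" if "x \<in> I <+> J" for x using that assms mem_pri_idem by simp
  have I: "e \<otimes> x = x \<and> f \<otimes> x = \<zero>" if x: "x \<in> I" for x
  proof -
    have xc: "x \<in> carrier R" using x assms pris_mem_carrier by blast
    have "x \<in> I <+> J" using x assms subset_set_add1 by blast
    then have *: "x = e \<otimes> x \<oplus> f \<otimes> x" using kx[of x] ef c xc by (simp add: l_distr)
    have "f \<otimes> x = x \<ominus> e \<otimes> x" using c xc diff_cancel by (subst (2) *) simp
    then have "f \<otimes> x \<in> I" using x ef xc assms by (simp add: pris_diff pris_mult)
    moreover have "f \<otimes> x \<in> J" using ef xc assms by (simp add: pris_mult)
    ultimately have "f \<otimes> x = \<zero>" using assms by blast
    then show ?thesis using * c xc by simp
  qed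
  have J: "f \<otimes> x = x \<and> e \<otimes> x = \<zero>" if x: "x \<in> J" for x
  proof -
    have xc: "x \<in> carrier R" using x assms pris_mem_carrier by blast
    have "x \<in> I <+> J" using x assms subset_set_add2 by blast
    then have *: "x = e \<otimes> x \<oplus> f \<otimes> x" using kx[of x] ef c xc by (simp add: l_distr)
    have "e \<otimes> x = x \<ominus> f \<otimes> x" using c xc diff_cancel by (subst (2) *) simp
    then have "e \<otimes> x \<in> J" using x ef xc assms by (simp add: pris_diff pris_mult)
    moreover have "e \<otimes> x \<in> I" using ef xc assms by (simp add: pris_mult)
    ultimately have "e \<otimes> x = \<zero>" using assms by blast
    then show ?thesis using * c xc by simp
  qed
  have "I = pri e"
  proof
    show "I \<subseteq> pri e" using I pri_mult_mem[of _ e] assms pris_mem_carrier by (metis subsetI)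
    show "pri e \<subseteq> I" using ef c assms by (simp add: pri_subset_iff)
  qed
  moreover have "J = pri f"
  proof
    show "J \<subseteq> pri f" using J pri_mult_mem[of _ f] assms pris_mem_carrier by (metis subsetI)
    show "pri f \<subseteq> J" using ef c assms by (simp add: pri_subset_iff)
  qed
  ultimately show ?thesis using that[of e f] ef c I J by simp
qed

lemma modular_law:
  assumes "I \<in> pris" "J \<in> pris" "K \<in> pris" "I \<subseteq> K"
  shows "(I <+> J) \<inter> K = I <+> (J \<inter> K)"
proof
  show "(I <+> J) \<inter> K \<subseteq> I <+> (J \<inter> K)"
  proof
    fix x assume x: "x \<in> (I <+> J) \<inter> K"
    then obtain i j where ij: "i \<in> I" "j \<in> J" "x = i \<oplus> j" by (auto simp: mem_set_add)
    have "i \<in> carrier R" "j \<in> carrier R" using ij assms pris_mem_carrier by auto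
    then have "j = x \<ominus> i" using ij diff_cancel by simp
    then have "j \<in> K" using x ij assms pris_diff[of K x i] by auto
    then show "x \<in> I <+> (J \<inter> K)" using ij by (auto simp: mem_set_add)
  qed
  show "I <+> (J \<inter> K) \<subseteq> (I <+> J) \<inter> K"
    using assms subset_set_add1[of I J] set_add_subset[of K I "J \<inter> K"]
      set_add_mono[of I I "J \<inter> K" J] by blast
qed

end

section \<open>Rank functions\<close>

locale ranked_ring = regular_ring +
  fixes rk :: "'a \<Rightarrow> real"
  assumes rank: "rank_function R rk"
begin

text \<open>Generators of the same right ideal are right multiples of each other and so have equal
  rank; the choice is immaterial. This is von Neumann's dimension function on the lattice.\<close>

definition dim :: "'a set \<Rightarrow> real" where
  "dim I = rk (SOME a. a \<in> carrier R \<and> I = pri a)"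

lemma rk_range: "a \<in> carrier R \<Longrightarrow> 0 \<le> rk a \<and> rk a \<le> 1"
  using rank unfolding rank_function_def by (simp add: Pi_iff)

lemma rk_one: "rk \<one> = 1"
  using rank unfolding rank_function_def by blast

lemma rk_mult: 
  assumes "a \<in> carrier R" "b \<in> carrier R"
  shows "rk (a \<otimes> b) \<le> rk a" "rk (a \<otimes> b) \<le> rk b"
  using rank assms unfolding rank_function_def by auto

lemma rk_orthogonal_add:
  assumes "e \<in> carrier R" "f \<in> carrier R" "e \<otimes> e = e" "f \<otimes> f = f" "e \<otimes> f = \<zero>" "f \<otimes> e = \<zero>"
  shows "rk (e \<oplus> f) = rk e + rk f"
  using rank assms unfolding rank_function_def by blast

lemma rk_eq_zero: "a \<in> carrier R \<Longrightarrow> rk a = 0 \<longleftrightarrow> a = \<zero>"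
  using rank rk_orthogonal_add[of \<zero> \<zero>] unfolding rank_function_def by auto

lemma rk_le_of_mem_pri: "a \<in> carrier R \<Longrightarrow> x \<in> pri a \<Longrightarrow> rk x \<le> rk a"
  by (auto simp: principal_right_ideal_def rk_mult)

lemma dim_pri: 
  assumes "a \<in> carrier R" shows "dim (pri a) = rk a"
proof -
  define b where "b = (SOME b. b \<in> carrier R \<and> pri a = pri b)"
  have b: "b \<in> carrier R \<and> pri a = pri b"
    unfolding b_def by (rule someI[of _ a]) (use assms in simp)
  have "b \<in> pri a" "a \<in> pri b" using b assms generator_mem_pri by auto
  then have "rk b = rk a" using b assms rk_le_of_mem_pri by (metis order_antisym)
  then show ?thesis by (simp add: dim_def b_def)
qed

lemma dim_nonneg: "I \<in> pris \<Longrightarrow> 0 \<le> dim I"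
  by (auto simp: pris_eq dim_pri rk_range)

lemma dim_eq_zero: "I \<in> pris \<Longrightarrow> dim I = 0 \<Longrightarrow> I = {\<zero>}"
  by (auto simp: pris_eq dim_pri rk_eq_zero) (auto simp: principal_right_ideal_def)

lemma dim_zero: "dim {\<zero>} = 0"
proof -
  have "pri \<zero> = {\<zero>}" by (auto simp: principal_right_ideal_def)
  then show ?thesis using dim_pri[of \<zero>] rk_eq_zero[of \<zero>] by simp
qed

text \<open>The rank is additive on orthogonal idempotents, and independent right ideals are
  generated by such a pair.\<close>

lemma dim_set_add:
  assumes "I \<in> pris" "J \<in> pris" "I \<inter> J = {\<zero>}"
  shows "dim (I <+> J) = dim I + dim J"
proof -
  obtain k where k: "k \<in> carrier R" "k \<otimes> k = k" "I <+> J = pri k"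
    using pris_idem[OF pris_set_add[OF assms(1,2)]] .
  obtain e f where "e \<in> carrier R" "f \<in> carrier R" "e \<otimes> e = e" "f \<otimes> f = f"
    "e \<otimes> f = \<zero>" "f \<otimes> e = \<zero>" "I = pri e" "J = pri f" "k = e \<oplus> f"
    using disjoint_orthogonal_idems[OF assms k] by blast
  then show ?thesis using k by (simp add: dim_pri rk_orthogonal_add)
qed

lemma dim_mono: 
  assumes "I \<in> pris" "J \<in> pris" "I \<subseteq> J" shows "dim I \<le> dim J"
proof -
  obtain K where "K \<in> pris" "I \<inter> K = {\<zero>}" "I <+> K = J" using pris_complement[OF assms(1-3)] .
  then show ?thesis using dim_set_add[of I K] dim_nonneg[of K] assms by simp
qed

text \<open>Faithfulness of the rank: a relative complement of \<open>I\<close> in \<open>J\<close>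
  has dimension 0 and therefore vanishes.\<close>

lemma dim_subset_eq: 
  assumes "I \<in> pris" "J \<in> pris" "I \<subseteq> J" "dim J \<le> dim I" shows "I = J"
proof -
  obtain K where K: "K \<in> pris" "I \<inter> K = {\<zero>}" "I <+> K = J" using pris_complement[OF assms(1-3)] .
  then have "dim K = 0" using dim_set_add[of I K] dim_nonneg[of K] assms by simp
  then have "K \<subseteq> I" using dim_eq_zero K pris_zero assms by auto
  then show ?thesis using K assms set_add_subset[of I I K] by auto
qed

lemma dim_set_add_le:
  assumes "I \<in> pris" "J \<in> pris" shows "dim (I <+> J) \<le> dim I + dim J"
proof -
  have IJ: "I \<inter> J \<in> pris" using assms by (rule pris_Int)
  obtain K where K: "K \<in> pris" "K \<subseteq> J" "(I \<inter> J) \<inter> K = {\<zero>}" "(I \<inter> J) <+> K = J"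
    using pris_complement[OF IJ assms(2) Int_lower2] .
  have IK: "I \<subseteq> I <+> K" "K \<subseteq> I <+> K" "I <+> K \<in> pris"
    using subset_set_add1[OF assms(1) K(1)] subset_set_add2[OF assms(1) K(1)]
      pris_set_add[OF assms(1) K(1)] by auto
  then have "I \<inter> J <+> K \<subseteq> I <+> K" by (intro set_add_subset) auto
  then have "J \<subseteq> I <+> K" by (simp only: K)
  then have "I <+> J \<subseteq> I <+> K" using IK by (intro set_add_subset)
  then have "dim (I <+> J) \<le> dim (I <+> K)" using assms K by (simp add: dim_mono pris_set_add)
  also have "\<dots> = dim I + dim K" using assms K by (intro dim_set_add) auto
  also have "\<dots> \<le> dim I + dim J" using K assms by (simp add: dim_mono)
  finally show ?thesis .
qed

lemma rk_add_le: 
  assumes "a \<in> carrier R" "b \<in> carrier R" shows "rk (a \<oplus> b) \<le> rk a + rk b"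
proof -
  have "a \<oplus> b \<in> pri a <+> pri b" using assms generator_mem_pri by (auto simp: mem_set_add)
  then have "pri (a \<oplus> b) \<subseteq> pri a <+> pri b" 
    using assms by (simp add: pri_subset_iff pris_set_add)
  then have "dim (pri (a \<oplus> b)) \<le> dim (pri a) + dim (pri b)"
    using assms dim_set_add_le[of "pri a" "pri b"] dim_mono[of "pri (a \<oplus> b)" "pri a <+> pri b"]
    by (simp add: pris_set_add)
  then show ?thesis using assms by (simp add: dim_pri)
qed

lemma rk_neg: "a \<in> carrier R \<Longrightarrow> rk (\<ominus> a) = rk a"
  using rk_mult(2)[of "\<ominus> \<one>" a] rk_mult(2)[of "\<ominus> \<one>" "\<ominus> a"] by (simp add: l_minus)

section \<open>The rank metric and elements of small rank\<close>

lemma Metric_space_rank_dist: "Metric_space (carrier R) (rank_dist R rk)"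
proof
  fix x y z
  show "0 \<le> rank_dist R rk x y" by (simp add: rank_dist_def rk_range)
  show "rank_dist R rk x y = rank_dist R rk y x"
  proof (cases "x \<in> carrier R \<and> y \<in> carrier R")
    case True
    then have "y \<ominus> x = \<ominus> (x \<ominus> y)" by (simp add: ring_simprules)
    then show ?thesis using True by (simp add: rank_dist_def rk_neg)
  qed (auto simp: rank_dist_def)
  show "rank_dist R rk x y = 0 \<longleftrightarrow> x = y" if "x \<in> carrier R" "y \<in> carrier R"
    using that by (simp add: rank_dist_def rk_eq_zero diff_eq_zero)
  show "rank_dist R rk x z \<le> rank_dist R rk x y + rank_dist R rk y z"
    if "x \<in> carrier R" "y \<in> carrier R" "z \<in> carrier R"
  proof -
    have "x \<ominus> z = (x \<ominus> y) \<oplus> (y \<ominus> z)" using that by (simp add: ring_simprules)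
    then show ?thesis using that rk_add_le[of "x \<ominus> y" "y \<ominus> z"] by (simp add: rank_dist_def)
  qed
qed

text \<open>A positive lower bound for the ranks of non-zero elements would make every ball of that
  radius a singleton.\<close>

lemma nondiscrete_small_rank:
  assumes "rank_topology R rk \<noteq> discrete_topology (carrier R)" "0 < \<epsilon>"
  obtains x where "x \<in> carrier R" "x \<noteq> \<zero>" "rk x < \<epsilon>"
proof -
  interpret M: Metric_space "carrier R" "rank_dist R rk" by (rule Metric_space_rank_dist)
  have "\<exists>x\<in>carrier R. x \<noteq> \<zero> \<and> rk x < \<epsilon>"
  proof (rule ccontr)
    assume "\<not> ?thesis"
    then have big: "\<epsilon> \<le> rk x" if "x \<in> carrier R" "x \<noteq> \<zero>" for x using that by force
    have "openin M.mtopology {x}" if x: "x \<in> carrier R" for x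
    proof -
      have "M.mball x \<epsilon> \<subseteq> {x}"
      proof
        fix y assume "y \<in> M.mball x \<epsilon>"
        then have "y \<in> carrier R" "rk (x \<ominus> y) < \<epsilon>" using x by (auto simp: rank_dist_def)
        then show "y \<in> {x}" using big[of "x \<ominus> y"] x by (auto simp: diff_eq_zero)
      qed
      then show ?thesis using x \<open>0 < \<epsilon>\<close> by (auto simp: M.openin_mtopology)
    qed
    then have "M.mtopology = discrete_topology (carrier R)"
      by (metis discrete_topology_unique M.topspace_mtopology)
    then show False using assms(1) by (simp add: rank_topology_def)
  qed
  then show ?thesis using that by blast
qed

end

section \<open>Continuity of the lattice\<close>

context continuous_ring
begin

abbreviation Join :: "'a set set \<Rightarrow> 'a set" where
  "Join \<equiv> Lattice.sup (ring_lattice R)"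

lemma le_ring_lattice [simp]: "I \<sqsubseteq>\<^bsub>ring_lattice R\<^esub> J \<longleftrightarrow> I \<subseteq> J"
  by (simp add: ring_lattice_def)

lemma Join_least_upper:
  assumes "C \<subseteq> pris"
  shows "least (ring_lattice R) (Join C) (Upper (ring_lattice R) C)"
proof -
  interpret lat: complete_lattice "ring_lattice R" by (rule complete)
  show ?thesis by (rule lat.supI) (use assms in auto)
qed

lemma Join_in_pris: "C \<subseteq> pris \<Longrightarrow> Join C \<in> pris"
  using Join_least_upper by (auto simp: least_def Upper_def)

lemma Join_upper: "C \<subseteq> pris \<Longrightarrow> J \<in> C \<Longrightarrow> J \<subseteq> Join C"
  using Join_least_upper[of C] by (auto simp: least_def Upper_def)

lemma Join_least: "C \<subseteq> pris \<Longrightarrow> K \<in> pris \<Longrightarrow> (\<And>J. J \<in> C \<Longrightarrow> J \<subseteq> K) \<Longrightarrow> Join C \<subseteq> K"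
  using Join_least_upper[of C] by (auto simp: least_def Upper_def)

lemma Join_unique:
  assumes "C \<subseteq> pris" "K \<in> pris" "\<And>J. J \<in> C \<Longrightarrow> J \<subseteq> K"
    "\<And>M. M \<in> pris \<Longrightarrow> (\<And>J. J \<in> C \<Longrightarrow> J \<subseteq> M) \<Longrightarrow> K \<subseteq> M"
  shows "Join C = K"
  using assms Join_least[of C K] Join_upper Join_in_pris by (metis order_antisym)

text \<open>Infima in the lattice are intersections, since the elements of an intersection of
  principal right ideals generate principal right ideals below it.\<close>

lemma inf_ring_lattice:
  assumes "C \<subseteq> pris"
  shows "\<Sqinter>\<^bsub>ring_lattice R\<^esub> C = carrier R \<inter> \<Inter>C"
proof -
  interpret lat: complete_lattice "ring_lattice R" by (rule complete)
  have g: "greatest (ring_lattice R) (\<Sqinter>\<^bsub>ring_lattice R\<^esub> C) (Lower (ring_lattice R) C)"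
    by (rule lat.infI) (use assms in auto)
  then have inf: "\<Sqinter>\<^bsub>ring_lattice R\<^esub> C \<in> pris" by (auto simp: greatest_def Lower_def)
  show ?thesis
  proof
    show "\<Sqinter>\<^bsub>ring_lattice R\<^esub> C \<subseteq> carrier R \<inter> \<Inter>C"
      using g inf pris_carrier assms by (auto simp: greatest_def Lower_def)
    show "carrier R \<inter> \<Inter>C \<subseteq> \<Sqinter>\<^bsub>ring_lattice R\<^esub> C"
    proof
      fix x assume x: "x \<in> carrier R \<inter> \<Inter>C"
      then have "pri x \<in> Lower (ring_lattice R) C"
        using assms by (auto simp: Lower_def pri_subset_iff in_mono)
      then have "pri x \<subseteq> \<Sqinter>\<^bsub>ring_lattice R\<^esub> C" using g by (auto simp: greatest_def)
      then show "x \<in> \<Sqinter>\<^bsub>ring_lattice R\<^esub> C" using x generator_mem_pri by blast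
    qed
  qed
qed

text \<open>Non-emptiness matters: \<open>\<Inter>{}\<close> is the whole type, whereas the infimum
  of the empty family is \<open>carrier R\<close>.\<close>

lemma Inter_in_pris:
  assumes "C \<subseteq> pris" "C \<noteq> {}" shows "\<Inter>C \<in> pris"
proof -
  interpret lat: complete_lattice "ring_lattice R" by (rule complete)
  have "carrier R \<inter> \<Inter>C = \<Inter>C" using assms pris_carrier by blast
  moreover have "\<Sqinter>\<^bsub>ring_lattice R\<^esub> C \<in> pris" using assms by simp
  ultimately show ?thesis using inf_ring_lattice assms by simp
qed

lemma meet_ring_lattice:
  assumes "I \<in> pris" "J \<in> pris" shows "I \<sqinter>\<^bsub>ring_lattice R\<^esub> J = I \<inter> J"
  using assms inf_ring_lattice[of "{I, J}"] pris_carrier by (auto simp: meet_def)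

lemma join_ring_lattice:
  assumes "I \<in> pris" "J \<in> pris" shows "I \<squnion>\<^bsub>ring_lattice R\<^esub> J = I <+> J"
  unfolding join_def
proof (rule Join_unique)
  show "I <+> J \<in> pris" using assms by (rule pris_set_add)
  show "K \<subseteq> I <+> J" if "K \<in> {I, J}" for K
    using that subset_set_add1[OF assms] subset_set_add2[OF assms] by auto
  show "I <+> J \<subseteq> M" if "M \<in> pris" "\<And>K. K \<in> {I, J} \<Longrightarrow> K \<subseteq> M" for M
    using that by (intro set_add_subset) auto
qed (use assms in auto)

lemma Int_Join_chain:
  assumes "subset.chain pris C" "I \<in> pris"
  shows "I \<inter> Join C = Join ((\<inter>) I ` C)"
proof -
  have C: "C \<subseteq> pris" using assms by (simp add: subset_chain_def)
  then have "(\<lambda>J. I \<sqinter>\<^bsub>ring_lattice R\<^esub> J) ` C = (\<inter>) I ` C"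
    using assms by (intro image_cong) (auto simp: meet_ring_lattice)
  then show ?thesis
    using meet_continuous[OF assms] C assms(2) by (simp add: meet_ring_lattice Join_in_pris)
qed

lemma set_add_Inter_chain:
  assumes "subset.chain pris C" "C \<noteq> {}" "I \<in> pris"
  shows "I <+> \<Inter>C = \<Inter>((\<lambda>J. I <+> J) ` C)"
proof -
  have C: "C \<subseteq> pris" using assms by (simp add: subset_chain_def)
  have eq: "(\<lambda>J. I \<squnion>\<^bsub>ring_lattice R\<^esub> J) ` C = (\<lambda>J. I <+> J) ` C"
    using C assms by (intro image_cong) (auto simp: join_ring_lattice)
  have inf: "\<Sqinter>\<^bsub>ring_lattice R\<^esub> D = \<Inter>D" if "D \<subseteq> pris" "D \<noteq> {}" for D
    using inf_ring_lattice[of D] that pris_carrier by blast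
  have "(\<lambda>J. I <+> J) ` C \<subseteq> pris" using C assms(3) by (auto intro: pris_set_add)
  then show ?thesis
    using join_continuous[OF assms(1,3)] C assms inf Inter_in_pris[of C]
    by (simp add: eq join_ring_lattice)
qed

end

section \<open>Primeness\<close>

context ring
begin

text \<open>The Peirce decomposition: \<open>x \<mapsto> (zx, (1 - z)x)\<close> maps
  \<open>R\<close> isomorphically onto the product of two corners, with addition as its
  inverse.\<close>

lemma central_idem_decomposition:
  assumes z: "z \<in> carrier R" "z \<otimes> z = z" "\<And>r. r \<in> carrier R \<Longrightarrow> z \<otimes> r = r \<otimes> z"
    and nontrivial: "z \<noteq> \<zero>" "z \<noteq> \<one>"
  shows "\<not> irreducible_ring R"
proof -
  \<comment> \<open>The corner \<open>wR\<close> has unit \<open>w\<close> and lives on the element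
    type of \<open>R\<close>, as \<open>irreducible_ring\<close> demands of the factors.\<close>
  define corner where "corner = (\<lambda>w. \<lparr>carrier = (\<otimes>) w ` carrier R, monoid.mult = (\<otimes>), one = w, zero = \<zero>, add = (\<oplus>)\<rparr> :: 'a ring)"
  have mem: "x \<in> (\<otimes>) w ` carrier R \<longleftrightarrow> x \<in> carrier R \<and> w \<otimes> x = x" if "w \<in> carrier R" "w \<otimes> w = w" for w x
    using mem_pri_idem[OF that] by (simp add: principal_right_ideal_def)
  have ring_corner: "ring (corner w)"
    if w: "w \<in> carrier R" "w \<otimes> w = w" "\<And>r. r \<in> carrier R \<Longrightarrow> w \<otimes> r = r \<otimes> w" for w
  proof -
    have carr: "x \<in> carrier (corner w) \<longleftrightarrow> x \<in> carrier R \<and> w \<otimes> x = x" for x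
      using mem[OF w(1,2)] by (simp add: corner_def)
    have ops: "x \<oplus>\<^bsub>corner w\<^esub> y = x \<oplus> y" "x \<otimes>\<^bsub>corner w\<^esub> y = x \<otimes> y" "\<zero>\<^bsub>corner w\<^esub> = \<zero>" "\<one>\<^bsub>corner w\<^esub> = w" for x y
      by (simp_all add: corner_def)
    have "abelian_group (corner w)"
    proof (rule abelian_groupI)
      show "\<exists>y\<in>carrier (corner w). y \<oplus>\<^bsub>corner w\<^esub> x = \<zero>\<^bsub>corner w\<^esub>" if "x \<in> carrier (corner w)" for x
        using that w(1,2) by (intro bexI[of _ "\<ominus> x"]) (auto simp: carr ops r_minus l_neg)
    qed (use w(1,2) in \<open>auto simp: carr ops r_distr a_assoc intro: a_comm\<close>)
    moreover have "monoid (corner w)"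
    proof (rule monoidI)
      show "x \<otimes>\<^bsub>corner w\<^esub> y \<in> carrier (corner w)" if "x \<in> carrier (corner w)" "y \<in> carrier (corner w)" for x y
        using that m_assoc[OF w(1), of x y] by (auto simp: carr ops)
      show "x \<otimes>\<^bsub>corner w\<^esub> \<one>\<^bsub>corner w\<^esub> = x" if "x \<in> carrier (corner w)" for x
        using that w(3)[of x] by (auto simp: carr ops simp del: m_assoc)
    qed (use w(1,2) in \<open>auto simp: carr ops m_assoc\<close>)
    ultimately show ?thesis
      by (rule ringI) (auto simp: carr ops l_distr r_distr)
  qed
  define z' where "z' = \<one> \<ominus> z"
  have z': "z' \<in> carrier R" "z' \<otimes> z' = z'" "z' \<noteq> \<zero>" "z \<otimes> z' = \<zero>" "z' \<otimes> z = \<zero>"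
    using z(1,2) nontrivial idem_compl[of z] diff_eq_zero[of \<one> z] by (auto simp: z'_def)
  have z'_comm: "z' \<otimes> r = r \<otimes> z'" if "r \<in> carrier R" for r
    using that z(1) z(3)[OF that] by (simp add: z'_def minus_eq l_distr r_distr l_minus r_minus)
  have zz': "z \<oplus> z' = \<one>" using z(1) by (simp add: z'_def minus_eq a_lcomm[of z] r_neg)
  have "(\<lambda>x. (z \<otimes> x, z' \<otimes> x)) \<in> ring_iso R (RDirProd (corner z) (corner z'))"
  proof (intro ring_iso_memI)
    have comm: "w \<otimes> (x \<otimes> y) = w \<otimes> x \<otimes> (w \<otimes> y)"
      if w: "w \<in> carrier R" "w \<otimes> w = w" "\<And>r. r \<in> carrier R \<Longrightarrow> w \<otimes> r = r \<otimes> w"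
        and xy: "x \<in> carrier R" "y \<in> carrier R" for w x y
      by (metis m_assoc m_closed w xy)
    fix x y assume xy: "x \<in> carrier R" "y \<in> carrier R"
    show "(z \<otimes> x, z' \<otimes> x) \<in> carrier (RDirProd (corner z) (corner z'))"
      using xy by (simp add: RDirProd_carrier corner_def)
    show "(z \<otimes> (x \<otimes> y), z' \<otimes> (x \<otimes> y)) =
      (z \<otimes> x, z' \<otimes> x) \<otimes>\<^bsub>RDirProd (corner z) (corner z')\<^esub> (z \<otimes> y, z' \<otimes> y)"
      using xy comm[OF z, of x y] comm[OF z'(1,2) z'_comm, of x y]
      by (simp add: RDirProd_def DirProd_def monoid.defs corner_def)
    show "(z \<otimes> (x \<oplus> y), z' \<otimes> (x \<oplus> y)) =
      (z \<otimes> x, z' \<otimes> x) \<oplus>\<^bsub>RDirProd (corner z) (corner z')\<^esub> (z \<otimes> y, z' \<otimes> y)"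
      using xy z(1) z' by (simp add: RDirProd_def DirProd_def monoid.defs corner_def r_distr)
  next
    show "(z \<otimes> \<one>, z' \<otimes> \<one>) = \<one>\<^bsub>RDirProd (corner z) (corner z')\<^esub>"
      using z(1) z' by (simp add: RDirProd_def DirProd_def monoid.defs corner_def)
    show "bij_betw (\<lambda>x. (z \<otimes> x, z' \<otimes> x)) (carrier R) (carrier (RDirProd (corner z) (corner z')))"
    proof (rule bij_betwI[where g = "\<lambda>(x, y). x \<oplus> y"])
      show "(\<lambda>x. (z \<otimes> x, z' \<otimes> x)) \<in> carrier R \<rightarrow> carrier (RDirProd (corner z) (corner z'))"
        by (auto simp: RDirProd_carrier corner_def)
      show "(\<lambda>(x, y). x \<oplus> y) \<in> carrier (RDirProd (corner z) (corner z')) \<rightarrow> carrier R"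
        using z(1) z' by (auto simp: RDirProd_carrier corner_def)
      show "(\<lambda>(x, y). x \<oplus> y) (z \<otimes> x, z' \<otimes> x) = x" if "x \<in> carrier R" for x
        using that z(1) z' zz' by (simp flip: l_distr)
      show "(z \<otimes> ((\<lambda>(x, y). x \<oplus> y) p), z' \<otimes> ((\<lambda>(x, y). x \<oplus> y) p)) = p"
        if "p \<in> carrier (RDirProd (corner z) (corner z'))" for p
        using that z(1,2) z' by (auto simp: RDirProd_carrier corner_def r_distr simp flip: m_assoc)
    qed
  qed
  then have "R \<simeq> RDirProd (corner z) (corner z')" by (auto simp: is_ring_iso_def)
  moreover have "carrier (corner z) \<noteq> {\<zero>\<^bsub>corner z\<^esub>}" "carrier (corner z') \<noteq> {\<zero>\<^bsub>corner z'\<^esub>}"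
    using z(1,2) z' nontrivial mem by (auto simp: corner_def)
  ultimately show ?thesis
    using ring_corner[OF z] ring_corner[OF z'(1,2) z'_comm] unfolding irreducible_ring_def by blast
qed

end

context continuous_ring
begin

text \<open>The annihilator of \<open>bR\<close> is a two-sided ideal and an intersection of principal right ideals,
  hence generated by a central idempotent.\<close>

lemma irreducible_imp_prime:
  assumes irr: "irreducible_ring R"
    and ab: "a \<in> carrier R" "b \<in> carrier R" "\<And>r. r \<in> carrier R \<Longrightarrow> b \<otimes> r \<otimes> a = \<zero>"
  shows "a = \<zero> \<or> b = \<zero>"
proof (rule ccontr)
  assume neg: "\<not> (a = \<zero> \<or> b = \<zero>)"
  define C where "C = (\<lambda>r. {x \<in> carrier R. b \<otimes> r \<otimes> x = \<zero>}) ` carrier R"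
  have "\<Inter>C \<in> pris"
    using ab by (intro Inter_in_pris) (auto simp: C_def intro: annihilator_in_pris)
  then obtain z where z: "z \<in> carrier R" "z \<otimes> z = z" "\<Inter>C = pri z" using pris_idem by blast
  have N: "x \<in> pri z \<longleftrightarrow> x \<in> carrier R \<and> (\<forall>r\<in>carrier R. b \<otimes> r \<otimes> x = \<zero>)" for x
    using one_closed unfolding z(3)[symmetric] C_def by blast
  have zN: "z \<in> pri z" using z generator_mem_pri by blast
  have left: "z \<otimes> (r \<otimes> z) = r \<otimes> z" if r: "r \<in> carrier R" for r
  proof -
    have "b \<otimes> s \<otimes> (r \<otimes> z) = b \<otimes> (s \<otimes> r) \<otimes> z" if "s \<in> carrier R" for s
      using that r z ab by (simp add: m_assoc)
    then have "r \<otimes> z \<in> pri z" using N zN r z by auto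
    then show ?thesis using z mem_pri_idem by blast
  qed
  \<comment> \<open>By the previous step, \<open>(1 - z)Rz = 0\<close>. For
    \<open>y = zr(1 - z)\<close> this gives \<open>yy'y = yy'zy = 0\<close>, so \<open>y = 0\<close>
    by regularity, and \<open>zr = zrz = rz\<close>.\<close>
  have central: "z \<otimes> r = r \<otimes> z" if r: "r \<in> carrier R" for r
  proof -
    define y where "y = z \<otimes> r \<otimes> (\<one> \<ominus> z)"
    have y: "y \<in> carrier R" using z r by (simp add: y_def)
    obtain y' where y': "y' \<in> carrier R" "y \<otimes> y' \<otimes> y = y" using regular y by blast
    have "(\<one> \<ominus> z) \<otimes> (y' \<otimes> z) = \<zero>"
      using left[OF y'(1)] y' z by (simp add: minus_eq l_distr l_minus r_neg)
    then have "y \<otimes> y' \<otimes> z = \<zero>" using y' z r by (simp add: y_def m_assoc)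
    moreover have "z \<otimes> y = y" using z r by (simp add: y_def flip: m_assoc)
    ultimately have "y \<otimes> y' \<otimes> y = \<zero>"
      using y y' z by (metis l_null m_assoc m_closed)
    then have "z \<otimes> r \<otimes> (\<one> \<ominus> z) = \<zero>" using y' y_def by simp
    then have "z \<otimes> r \<ominus> z \<otimes> r \<otimes> z = \<zero>" using z r by (simp add: minus_eq r_distr r_minus)
    then have "z \<otimes> r = z \<otimes> r \<otimes> z" using z r by (simp add: diff_eq_zero)
    then show ?thesis using left[OF r] z r by (simp add: m_assoc)
  qed
  have "a \<in> pri z" using ab N by blast
  then have "z \<noteq> \<zero>" using neg z mem_pri_idem ab by auto
  moreover have "z \<noteq> \<one>" 
  proof
    assume "z = \<one>"
    then have "b \<otimes> \<one> \<otimes> \<one> = \<zero>" using N[of \<one>] zN by simp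
    then show False using neg ab by simp
  qed
  ultimately show False using central_idem_decomposition[OF z(1,2) central] irr by blast
qed

text \<open>If \<open>zwz = z\<close> with \<open>z\<close> central, then
  \<open>zR(1 - zw) = 0\<close>, and primeness leaves \<open>zw = 1\<close>. This serves to invert
  the leading coefficient of a polynomial.\<close>

lemma irreducible_imp_central_unit:
  assumes irr: "irreducible_ring R" and z: "z \<in> ring_center R" "z \<noteq> \<zero>"
  obtains w where "w \<in> carrier R" "z \<otimes> w = \<one>"
proof -
  have zc: "z \<in> carrier R" and comm: "\<And>r. r \<in> carrier R \<Longrightarrow> z \<otimes> r = r \<otimes> z"
    using z by (auto simp: ring_center_def)
  obtain w where w: "w \<in> carrier R" "z \<otimes> w \<otimes> z = z" using regular zc by blast
  have "z \<otimes> (\<one> \<ominus> z \<otimes> w) = \<zero>"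
  proof -
    have "z \<otimes> (z \<otimes> w) = z" using w zc comm[of "z \<otimes> w"] by simp
    then show ?thesis using w zc by (simp add: minus_eq r_distr r_minus r_neg)
  qed
  then have "z \<otimes> r \<otimes> (\<one> \<ominus> z \<otimes> w) = \<zero>" if "r \<in> carrier R" for r
    using that zc w by (metis comm m_assoc minus_closed m_closed one_closed r_null)
  then have "\<one> \<ominus> z \<otimes> w = \<zero>"
    using irreducible_imp_prime[OF irr, of "\<one> \<ominus> z \<otimes> w" z] zc w z by auto
  then show ?thesis using that w zc by (metis diff_eq_zero m_closed one_closed)
qed

end

section \<open>Graphs of partial isomorphisms\<close>

text \<open>If \<open>A \<inter> B = {\<zero>}\<close>, then the isomorphisms between a principal right ideal below \<open>A\<close> and one
  below \<open>B\<close> correspond to the principal right ideals \<open>G\<close> below \<open>A <+> B\<close> that meet \<open>A\<close> and \<open>B\<close>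
  trivially; domain and range of \<open>G\<close> are \<open>(G <+> B) \<inter> A\<close> and \<open>(G <+> A) \<inter> B\<close>. In this form, the
  union of a chain of isomorphisms is a supremum in the lattice.\<close>

definition (in ring) graph :: "'a set \<Rightarrow> 'a set \<Rightarrow> 'a set \<Rightarrow> bool" where
  "graph A B G \<longleftrightarrow> G \<in> pris \<and> G \<subseteq> A <+> B \<and> G \<inter> A = {\<zero>} \<and> G \<inter> B = {\<zero>}"

context regular_ring
begin

lemma graph_sym: 
  assumes "A \<in> pris" "B \<in> pris" shows "graph A B G \<longleftrightarrow> graph B A G"
  unfolding graph_def set_add_commute[OF assms] by blast

lemma graph_zero: 
  assumes "A \<in> pris" "B \<in> pris" shows "graph A B {\<zero>}"
  using assms pris_zero[of A] pris_zero[of B] pris_zero[OF pris_set_add[OF assms]]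
  by (auto simp: graph_def zero_in_pris)

text \<open>If \<open>x + y\<close> lies in \<open>A\<close>, with \<open>x\<close> in
  \<open>G\<close> and \<open>y\<close> in \<open>Y\<close>, then the \<open>B\<close>-components of
  \<open>x\<close> and \<open>y\<close> cancel. That of \<open>y\<close> hence lies in
  \<open>G <+> A\<close>, which \<open>B1\<close> avoids; so both components vanish, and with them
  \<open>x\<close> and \<open>y\<close>.\<close>

lemma graph_set_add_aux:
  assumes "A \<in> pris" "B \<in> pris" "A \<inter> B = {\<zero>}" "graph A B G"
    and "A1 \<in> pris" "A1 \<subseteq> A" "A1 \<inter> (G <+> B) = {\<zero>}"
    and "B1 \<in> pris" "B1 \<subseteq> B" "B1 \<inter> (G <+> A) = {\<zero>}"
    and "graph A1 B1 Y"
  shows "(G <+> Y) \<inter> A \<subseteq> {\<zero>}"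
proof
  have G: "G \<in> pris" "G \<subseteq> A <+> B" "G \<inter> A = {\<zero>}" and Y: "Y \<in> pris" "Y \<subseteq> A1 <+> B1" "Y \<inter> A1 = {\<zero>}"
    using assms(4,11) by (auto simp: graph_def)
  fix z assume z: "z \<in> (G <+> Y) \<inter> A"
  then obtain x y where xy: "x \<in> G" "y \<in> Y" "z = x \<oplus> y" by (auto simp: mem_set_add)
  obtain a b where ab: "a \<in> A" "b \<in> B" "x = a \<oplus> b" using xy(1) G(2) unfolding mem_set_add subset_iff by blast
  obtain a1 b1 where ab1: "a1 \<in> A1" "b1 \<in> B1" "y = a1 \<oplus> b1" using xy(2) Y(2) unfolding mem_set_add subset_iff by blast
  have c: "a \<in> carrier R" "b \<in> carrier R" "a1 \<in> carrier R" "b1 \<in> carrier R" "x \<in> carrier R" "z \<in> carrier R"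
    using ab ab1 xy z assms G by (auto intro: pris_mem_carrier)
  have "z \<ominus> (a \<oplus> a1) \<in> A" using z ab ab1 assms by (intro pris_diff pris_add) auto
  moreover have "z = (a \<oplus> a1) \<oplus> (b \<oplus> b1)" using xy ab ab1 c by (simp add: a_ac)
  ultimately have "b \<oplus> b1 \<in> A" using c diff_cancel(1)[of "a \<oplus> a1" "b \<oplus> b1"] by simp
  moreover have "b \<oplus> b1 \<in> B" using ab ab1 assms by (intro pris_add) auto
  ultimately have "b \<oplus> b1 = \<zero>" using assms(3) by blast
  then have b1: "b1 = \<ominus> b" using c by (metis a_comm minus_equality)
  have "\<ominus> b = \<ominus> x \<oplus> a" using ab c by (simp add: minus_add a_ac l_neg r_neg r_neg1 r_neg2)
  moreover have "\<ominus> x \<oplus> a \<in> G <+> A" using xy(1) ab(1) pris_neg[OF G(1)] by (auto simp: mem_set_add)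
  ultimately have "b1 \<in> G <+> A" using b1 by simp
  then have "b1 = \<zero>" using ab1 assms(10) by blast
  then have "y = a1" "b = \<zero>" using ab1 b1 c by (auto simp: r_neg minus_equality)
  then have "y = \<zero>" "x = a" using ab xy ab1 Y c by auto
  then have "x = \<zero>" using xy ab G by blast
  then show "z \<in> {\<zero>}" using xy \<open>y = \<zero>\<close> by simp
qed

text \<open>Partial isomorphisms with independent domains and independent ranges have a direct sum.
  The hypotheses on \<open>A1\<close> and \<open>B1\<close> say that they avoid the domain and the
  range of \<open>G\<close>.\<close>

lemma graph_set_add:
  assumes "A \<in> pris" "B \<in> pris" "A \<inter> B = {\<zero>}" "graph A B G"
    and "A1 \<in> pris" "A1 \<subseteq> A" "A1 \<inter> (G <+> B) = {\<zero>}"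
    and "B1 \<in> pris" "B1 \<subseteq> B" "B1 \<inter> (G <+> A) = {\<zero>}"
    and "graph A1 B1 Y"
  shows "graph A B (G <+> Y)"
proof -
  have G: "G \<in> pris" "G \<subseteq> A <+> B" and Y: "Y \<in> pris" "Y \<subseteq> A1 <+> B1"
    using assms(4,11) by (auto simp: graph_def)
  have XY: "G <+> Y \<in> pris" by (rule pris_set_add[OF G(1) Y(1)])
  have "Y \<subseteq> A <+> B" using Y(2) set_add_mono[OF assms(6,9)] by blast
  then have "G <+> Y \<subseteq> A <+> B" using G(2) pris_set_add[OF assms(1,2)] by (intro set_add_subset)
  moreover have "(G <+> Y) \<inter> A \<subseteq> {\<zero>}" by (rule graph_set_add_aux[OF assms])
  moreover have "(G <+> Y) \<inter> B \<subseteq> {\<zero>}"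
    using assms graph_sym[OF assms(1,2)] graph_sym[OF assms(5,8)]
    by (intro graph_set_add_aux[of B A G B1 A1 Y]) (auto simp: Int_commute)
  ultimately show ?thesis
    unfolding graph_def using XY pris_zero[OF XY] pris_zero[OF assms(1)] pris_zero[OF assms(2)] by blast
qed

end

text \<open>\<open>G\<close> and its domain are both complements of \<open>B\<close> in
  \<open>G <+> B\<close>; for the domain this is the modular law.\<close>

lemma (in ranked_ring) dim_graph_domain:
  assumes "A \<in> pris" "B \<in> pris" "A \<inter> B = {\<zero>}" "graph A B G"
  shows "dim ((G <+> B) \<inter> A) = dim G"
proof -
  have G: "G \<in> pris" "G \<subseteq> A <+> B" "G \<inter> B = {\<zero>}" using assms(4) by (auto simp: graph_def)
  have XB: "G <+> B \<in> pris" by (rule pris_set_add[OF G(1) assms(2)])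
  have A0: "A \<inter> (G <+> B) \<in> pris" by (rule pris_Int[OF assms(1) XB])
  have "G <+> B \<subseteq> A <+> B" 
    by (rule set_add_subset[OF pris_set_add[OF assms(1,2)] G(2) subset_set_add2[OF assms(1,2)]])
  then have "G <+> B = (B <+> A) \<inter> (G <+> B)" using set_add_commute[OF assms(1,2)] by blast
  also have "\<dots> = B <+> (A \<inter> (G <+> B))"
    by (rule modular_law[OF assms(2,1) XB subset_set_add2[OF G(1) assms(2)]])
  finally have eq: "G <+> B = B <+> (A \<inter> (G <+> B))" .
  have "B \<inter> (A \<inter> (G <+> B)) = {\<zero>}" 
    using assms(3) pris_zero[OF assms(2)] pris_zero[OF A0] by blast
  then have "dim G + dim B = dim B + dim (A \<inter> (G <+> B))"
    using dim_set_add[OF assms(2) A0] dim_set_add[OF G(1) assms(2) G(3)] eq by simp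
  then show ?thesis by (simp add: Int_commute)
qed

text \<open>Meet continuity keeps the intersections with \<open>A\<close> and \<open>B\<close>
  trivial in the supremum.\<close>

lemma (in continuous_ring) graph_Join:
  assumes "A \<in> pris" "B \<in> pris" "\<X> \<noteq> {}" "subset.chain {G. graph A B G} \<X>"
  shows "graph A B (Join \<X>)"
proof -
  have g: "graph A B G" if "G \<in> \<X>" for G using assms(4) that by (auto simp: subset_chain_def)
  then have sub: "\<X> \<subseteq> pris" by (auto simp: graph_def)
  then have chain: "subset.chain pris \<X>" using assms(4) by (auto simp: subset_chain_def)
  have "Join \<X> \<inter> C = {\<zero>}" if "C \<in> pris" "\<And>G. G \<in> \<X> \<Longrightarrow> G \<inter> C = {\<zero>}" for C
  proof -
    have "C \<inter> Join \<X> = Join ((\<inter>) C ` \<X>)" by (rule Int_Join_chain[OF chain that(1)])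
    also have "(\<inter>) C ` \<X> = {{\<zero>}}" using that(2) assms(3) by (force simp: Int_commute)
    also have "Join {{\<zero>}} = {\<zero>}" by (rule Join_unique) (auto simp: zero_in_pris)
    finally show ?thesis by blast
  qed
  moreover have "Join \<X> \<subseteq> A <+> B"
    using g by (intro Join_least sub pris_set_add assms(1,2)) (simp add: graph_def)
  ultimately show ?thesis
    using assms(1,2) g sub by (auto simp: graph_def Join_in_pris)
qed

section \<open>Continuity of the rank\<close>

locale nondiscrete_irreducible_ring = continuous_ring R + ranked_ring R rk
  for R :: "('a, 'b) ring_scheme" (structure) and rk +
  assumes irreducible: "irreducible_ring R"
    and nondiscrete: "rank_topology R rk \<noteq> discrete_topology (carrier R)"
begin

section \<open>Comparison of independent right ideals\<close>

lemma prime_ring: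
  assumes "a \<in> carrier R" "b \<in> carrier R" "a \<noteq> \<zero>" "b \<noteq> \<zero>"
  obtains r where "r \<in> carrier R" "b \<otimes> r \<otimes> a \<noteq> \<zero>"
  using irreducible_imp_prime[OF irreducible assms(1,2)] assms(3,4) by blast

text \<open>Left multiplication by an element of \<open>fRe\<close> maps \<open>eR\<close> into
  \<open>fR\<close>, and primeness provides a non-zero such element. Its restriction to a complement
  of its kernel is injective, and \<open>Y\<close> is the graph of this restriction.\<close>

lemma nonzero_graph:
  assumes "I \<in> pris" "J \<in> pris" "I \<inter> J = {\<zero>}" "I \<noteq> {\<zero>}" "J \<noteq> {\<zero>}"
  obtains Y where "graph I J Y" "Y \<noteq> {\<zero>}"
proof -
  obtain e where e: "e \<in> carrier R" "e \<otimes> e = e" "I = pri e" using pris_idem[OF assms(1)] .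
  obtain f where f: "f \<in> carrier R" "f \<otimes> f = f" "J = pri f" using pris_idem[OF assms(2)] .
  have "e \<noteq> \<zero>" "f \<noteq> \<zero>" using e(3) f(3) assms by (auto simp: principal_right_ideal_def)
  then obtain r where r: "r \<in> carrier R" "f \<otimes> r \<otimes> e \<noteq> \<zero>" using prime_ring[OF e(1) f(1)] by blast
  define u where "u = f \<otimes> r \<otimes> e"
  have u: "u \<in> carrier R" "u \<noteq> \<zero>" "u \<otimes> e = u" using e f r by (auto simp: u_def m_assoc)
  have uJ: "u \<in> J" using e f r by (simp add: u_def m_assoc pri_mult_mem)
  obtain v where v: "v \<in> carrier R" "u \<otimes> v \<otimes> u = u" using regular u by blast
  \<comment> \<open>An idempotent with image in \<open>I\<close> and the same right annihilator as
    \<open>u\<close>; thus \<open>u\<close> maps \<open>wR\<close> injectively onto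
    \<open>uR\<close>.\<close>
  define w where "w = e \<otimes> v \<otimes> u"
  have w: "w \<in> carrier R" using e v u by (simp add: w_def)
  have wI: "w \<in> I" using e v u by (simp add: w_def m_assoc pri_mult_mem)
  have uw: "u \<otimes> w = u"
  proof -
    have "u \<otimes> w = u \<otimes> e \<otimes> v \<otimes> u" using e v u(1) by (simp add: w_def m_assoc)
    then show ?thesis using u v by simp
  qed
  have wu: "w \<otimes> x = \<zero>" if "x \<in> carrier R" "u \<otimes> x = \<zero>" for x
    using that e v u by (simp add: w_def m_assoc)
  define Y where "Y = pri (w \<oplus> u)"
  have Y: "Y \<in> pris" using w u by (simp add: Y_def)
  have "w \<oplus> u \<in> I <+> J" using wI uJ by (auto simp: mem_set_add)
  then have sub: "Y \<subseteq> I <+> J" using w u pris_set_add[OF assms(1,2)] by (simp add: Y_def pri_subset_iff)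
  have mem: "\<exists>x\<in>carrier R. y = w \<otimes> x \<oplus> u \<otimes> x \<and> w \<otimes> x \<in> I \<and> u \<otimes> x \<in> J" if "y \<in> Y" for y
    using that w u pris_mult[OF assms(1) wI] pris_mult[OF assms(2) uJ]
    by (auto simp: Y_def principal_right_ideal_def l_distr)
  have "y = \<zero>" if y: "y \<in> Y" "y \<in> I" for y
  proof -
    obtain x where x: "x \<in> carrier R" "y = w \<otimes> x \<oplus> u \<otimes> x" "w \<otimes> x \<in> I" "u \<otimes> x \<in> J" using mem y by blast
    have "y \<ominus> w \<otimes> x \<in> I" using y x assms by (blast intro: pris_diff)
    then have "u \<otimes> x \<in> I" using x w u diff_cancel(1) by simp
    then have "u \<otimes> x = \<zero>" using x assms by blast
    then show ?thesis using wu x by simp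
  qed
  moreover have "y = \<zero>" if y: "y \<in> Y" "y \<in> J" for y
  proof -
    obtain x where x: "x \<in> carrier R" "y = w \<otimes> x \<oplus> u \<otimes> x" "w \<otimes> x \<in> I" "u \<otimes> x \<in> J" using mem y by blast
    have "y \<ominus> u \<otimes> x \<in> J" using y x assms by (blast intro: pris_diff)
    then have "w \<otimes> x \<in> J" using x w u diff_cancel(2) by simp
    then have wx: "w \<otimes> x = \<zero>" using x assms by blast
    have "u \<otimes> x = u \<otimes> (w \<otimes> x)" using uw x w u by (metis m_assoc)
    then show ?thesis using wx u x by simp
  qed
  ultimately have "graph I J Y"
    unfolding graph_def using Y sub pris_zero[OF Y] pris_zero[OF assms(1)] pris_zero[OF assms(2)] by blast
  moreover have "Y \<noteq> {\<zero>}"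
  proof
    assume "Y = {\<zero>}"
    then have "w \<oplus> u = \<zero>" using generator_mem_pri[of "w \<oplus> u"] w u by (simp add: Y_def)
    then have "u = \<ominus> w" using w u by (metis a_comm minus_equality minus_minus)
    then have "u \<in> I" using pris_neg[OF assms(1) wI] by simp
    then show False using uJ u assms by blast
  qed
  ultimately show ?thesis using that by blast
qed

text \<open>For a maximal graph, the complement of the domain in \<open>A\<close> or that of the
  range in \<open>B\<close> is zero: otherwise primeness would provide a non-zero graph between the
  two complements, by which the maximal one could be extended.\<close>

lemma comparable:
  assumes "A \<in> pris" "B \<in> pris" "A \<inter> B = {\<zero>}"
  obtains G where "graph A B G" "A \<subseteq> G <+> B \<or> B \<subseteq> G <+> A"
proof -
  have "\<exists>G\<in>{G. graph A B G}. \<forall>Y\<in>{G. graph A B G}. G \<subseteq> Y \<longrightarrow> Y = G"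
  proof (rule subset_Zorn)
    fix \<X> assume chain: "subset.chain {G. graph A B G} \<X>"
    show "\<exists>U\<in>{G. graph A B G}. \<forall>G\<in>\<X>. G \<subseteq> U"
    proof (cases "\<X> = {}")
      case True
      then show ?thesis using graph_zero[OF assms(1,2)] by blast
    next
      case False
      have "\<X> \<subseteq> pris" using chain by (auto simp: subset_chain_def graph_def)
      then show ?thesis
        using graph_Join[OF assms(1,2) False chain] Join_upper by blast
    qed
  qed
  then obtain G where G: "graph A B G" and max: "\<And>Y. graph A B Y \<Longrightarrow> G \<subseteq> Y \<Longrightarrow> Y = G" by blast
  have Xp: "G \<in> pris" using G by (simp add: graph_def)
  have XA: "G <+> A \<in> pris" and XB: "G <+> B \<in> pris" using Xp assms by (auto intro: pris_set_add)
  have A0: "A \<inter> (G <+> B) \<in> pris" and B0: "B \<inter> (G <+> A) \<in> pris"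
    using XA XB assms by (auto intro: pris_Int)
  obtain A1 where A1: "A1 \<in> pris" "A1 \<subseteq> A" "A \<inter> (G <+> B) \<inter> A1 = {\<zero>}" "A \<inter> (G <+> B) <+> A1 = A"
    using pris_complement[OF A0 assms(1) Int_lower1] .
  obtain B1 where B1: "B1 \<in> pris" "B1 \<subseteq> B" "B \<inter> (G <+> A) \<inter> B1 = {\<zero>}" "B \<inter> (G <+> A) <+> B1 = B"
    using pris_complement[OF B0 assms(2) Int_lower1] .
  have AB1: "A1 \<inter> B1 = {\<zero>}" 
    using A1(2) B1(2) assms(3) pris_zero[OF A1(1)] pris_zero[OF B1(1)] by blast
  have dA: "A1 \<inter> (G <+> B) = {\<zero>}" and dB: "B1 \<inter> (G <+> A) = {\<zero>}"
    using A1 B1 by blast+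
  have "A1 = {\<zero>} \<or> B1 = {\<zero>}"
  proof (rule ccontr)
    assume "\<not> ?thesis"
    then obtain Y where Y: "graph A1 B1 Y" "Y \<noteq> {\<zero>}" using nonzero_graph[OF A1(1) B1(1) AB1] by blast
    have Yp: "Y \<in> pris" "Y \<subseteq> A1 <+> B1" "Y \<inter> B1 = {\<zero>}" using Y by (auto simp: graph_def)
    have "graph A B (G <+> Y)"
      by (rule graph_set_add[OF assms G A1(1,2) dA B1(1,2) dB Y(1)])
    then have "G <+> Y = G" using max subset_set_add1[OF Xp Yp(1)] by blast
    then have YX: "Y \<subseteq> G" using subset_set_add2[OF Xp Yp(1)] by blast
    \<comment> \<open>Since \<open>Y\<close> lies in \<open>G\<close>, its
      \<open>A1\<close>-components lie in the domain of \<open>G\<close>, which \<open>A1\<close>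
      avoids.\<close>
    have "y = \<zero>" if y: "y \<in> Y" for y
    proof -
      obtain a b where ab: "a \<in> A1" "b \<in> B1" "y = a \<oplus> b" using y Yp(2) unfolding mem_set_add subset_iff by blast
      have c: "a \<in> carrier R" "b \<in> carrier R" using ab A1(1) B1(1) by (auto intro: pris_mem_carrier)
      have "y \<in> G" "\<ominus> b \<in> B" using y YX ab(2) B1(2) pris_neg[OF assms(2)] by auto
      then have "y \<oplus> \<ominus> b \<in> G <+> B" unfolding mem_set_add by blast
      moreover have "y \<oplus> \<ominus> b = a" using ab c diff_cancel(2) by (simp add: minus_eq)
      ultimately have "a = \<zero>" using ab dA by auto
      then show ?thesis using ab c y Yp(3) by auto
    qed
    then show False using Y(2) pris_zero[OF Yp(1)] by blast
  qed
  then show ?thesis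
  proof
    assume A: "A1 = {\<zero>}"
    have "A \<inter> (G <+> B) <+> A1 \<subseteq> G <+> B" 
      using XB A pris_zero[OF XB] by (intro set_add_subset) auto
    then show ?thesis using that[OF G] A1(4) by simp
  next
    assume B: "B1 = {\<zero>}"
    have "B \<inter> (G <+> A) <+> B1 \<subseteq> G <+> A" 
      using XA B pris_zero[OF XA] by (intro set_add_subset) auto
    then show ?thesis using that[OF G] B1(4) by simp
  qed
qed

text \<open>If comparability embeds \<open>B\<close> into \<open>A\<close> instead, then
  \<open>dim B \<le> dim G\<close>, and \<open>dim A \<le> dim B\<close> forces
  \<open>G <+> B\<close> to be all of \<open>A <+> B\<close>.\<close>

lemma embedding_of_dim_le:
  assumes "A \<in> pris" "B \<in> pris" "A \<inter> B = {\<zero>}" "dim A \<le> dim B"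
  obtains G where "graph A B G" "A \<subseteq> G <+> B"
proof -
  obtain G where G: "graph A B G" "A \<subseteq> G <+> B \<or> B \<subseteq> G <+> A" using comparable[OF assms(1-3)] .
  have Xp: "G \<in> pris" "G \<subseteq> A <+> B" "G \<inter> A = {\<zero>}" "G \<inter> B = {\<zero>}" using G by (auto simp: graph_def)
  have AB: "A <+> B \<in> pris" "A \<subseteq> A <+> B" "B \<subseteq> A <+> B"
    using pris_set_add[OF assms(1,2)] subset_set_add1[OF assms(1,2)] subset_set_add2[OF assms(1,2)] by auto
  have XA: "G <+> A \<in> pris" and XB: "G <+> B \<in> pris" using Xp assms by (auto intro: pris_set_add)
  have "A \<subseteq> G <+> B" if "B \<subseteq> G <+> A"
  proof -
    have "A <+> B \<subseteq> G <+> A" 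
      using XA subset_set_add2[OF Xp(1) assms(1)] that by (intro set_add_subset)
    then have "dim A + dim B \<le> dim G + dim A"
      using dim_mono[OF AB(1) XA] dim_set_add[OF assms(1-3)] dim_set_add[OF Xp(1) assms(1) Xp(3)] by simp
    then have "dim (A <+> B) \<le> dim (G <+> B)"
      using assms(4) dim_set_add[OF assms(1-3)] dim_set_add[OF Xp(1) assms(2) Xp(4)] by simp
    moreover have "G <+> B \<subseteq> A <+> B" using AB Xp by (intro set_add_subset)
    ultimately have "G <+> B = A <+> B" using dim_subset_eq[OF XB AB(1)] by simp
    then show ?thesis using AB by simp
  qed
  then show ?thesis using that[OF G(1)] G(2) by blast
qed

text \<open>An embedding of \<open>Join C\<close> into \<open>Q\<close> is assembled from embeddings of the members of \<open>C\<close> by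
  Zorn's lemma; its domains are required to be comparable with every member of \<open>C\<close>.\<close>

lemma dim_Join_chain_le:
  assumes C: "subset.chain pris C" and Q: "Q \<in> pris" "Join C \<inter> Q = {\<zero>}"
    and le: "\<And>J. J \<in> C \<Longrightarrow> dim J \<le> dim Q"
  shows "dim (Join C) \<le> dim Q"
proof -
  define A where "A = Join C"
  have Cp: "C \<subseteq> pris" using C by (simp add: subset_chain_def)
  have A: "A \<in> pris" using Cp by (simp add: A_def Join_in_pris)
  have AQ: "A \<inter> Q = {\<zero>}" using Q by (simp add: A_def)
  have JA: "J \<subseteq> A" if "J \<in> C" for J using that Cp by (simp add: A_def Join_upper)
  \<comment> \<open>In terms of domains, \<open>J \<subseteq> G <+> Q\<close> says that the domain
    contains \<open>J\<close>, and \<open>G \<subseteq> J <+> Q\<close> that it is contained in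
    \<open>J\<close>. So if \<open>G\<close> does not cover \<open>J\<close>, its whole domain lies
    in \<open>J\<close>, and what is left of \<open>J\<close> can be compared with what is left of
    \<open>Q\<close>.\<close>
  define \<Gamma> where "\<Gamma> = {G. graph A Q G \<and> (\<forall>J\<in>C. J \<subseteq> G <+> Q \<or> G \<subseteq> J <+> Q)}"
  have "\<exists>G\<in>\<Gamma>. \<forall>Y\<in>\<Gamma>. G \<subseteq> Y \<longrightarrow> Y = G"
  proof (rule subset_Zorn)
    fix \<X> assume chain: "subset.chain \<Gamma> \<X>"
    show "\<exists>U\<in>\<Gamma>. \<forall>G\<in>\<X>. G \<subseteq> U"
    proof (cases "\<X> = {}")
      case True
      have "\<zero> \<in> J <+> Q" if "J \<in> C" for J using that Cp Q(1) by (auto intro!: pris_zero pris_set_add)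
      then have "{\<zero>} \<in> \<Gamma>" using graph_zero[OF A Q(1)] by (auto simp: \<Gamma>_def)
      then show ?thesis using True by blast
    next
      case False
      have sub: "\<X> \<subseteq> pris" using chain by (auto simp: subset_chain_def graph_def \<Gamma>_def)
      have "subset.chain {G. graph A Q G} \<X>" using chain by (auto simp: subset_chain_def \<Gamma>_def)
      then have g: "graph A Q (Join \<X>)" using graph_Join[OF A Q(1) False] by blast
      have "J \<subseteq> Join \<X> <+> Q \<or> Join \<X> \<subseteq> J <+> Q" if J: "J \<in> C" for J
      proof (cases "\<exists>G\<in>\<X>. J \<subseteq> G <+> Q")
        case True
        then obtain G where "G \<in> \<X>" "J \<subseteq> G <+> Q" by blast
        then show ?thesis using set_add_mono[OF Join_upper[OF sub] subset_refl, of G Q] by blast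
      next
        case False
        then have "G \<subseteq> J <+> Q" if "G \<in> \<X>" for G 
          using that chain J by (auto simp: subset_chain_def \<Gamma>_def)
        moreover have "J <+> Q \<in> pris" using J Cp Q(1) by (auto intro: pris_set_add)
        ultimately show ?thesis using Join_least[OF sub] by blast
      qed
      then have "Join \<X> \<in> \<Gamma>" using g by (simp add: \<Gamma>_def)
      then show ?thesis using Join_upper[OF sub] by blast
    qed
  qed
  then obtain G where G: "G \<in> \<Gamma>" and max: "\<And>Y. Y \<in> \<Gamma> \<Longrightarrow> G \<subseteq> Y \<Longrightarrow> Y = G" by blast
  have g: "graph A Q G" using G by (simp add: \<Gamma>_def)
  have Xp: "G \<in> pris" "G \<subseteq> A <+> Q" "G \<inter> A = {\<zero>}" "G \<inter> Q = {\<zero>}" using g by (auto simp: graph_def)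
  have XQ: "G <+> Q \<in> pris" and XA: "G <+> A \<in> pris" and AQp: "A <+> Q \<in> pris"
    using Xp(1) A Q(1) by (auto intro: pris_set_add)
  have "J \<subseteq> G <+> Q" if J: "J \<in> C" for J
  proof (rule ccontr)
    assume neg: "\<not> J \<subseteq> G <+> Q"
    then have XJ: "G \<subseteq> J <+> Q" using G J by (auto simp: \<Gamma>_def)
    have Jp: "J \<in> pris" using J Cp by blast
    have JQ: "J \<inter> Q = {\<zero>}" using JA[OF J] AQ pris_zero[OF Jp] pris_zero[OF Q(1)] by blast
    have "G \<inter> J = {\<zero>}" using JA[OF J] Xp(3) pris_zero[OF Jp] pris_zero[OF Xp(1)] by blast
    then have gJ: "graph J Q G" using Xp XJ by (simp add: graph_def)
    have A0: "(G <+> Q) \<inter> J \<in> pris" and B0: "(G <+> A) \<inter> Q \<in> pris"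
      using XA XQ Jp Q(1) by (auto intro: pris_Int)
    obtain A1 where A1: "A1 \<in> pris" "A1 \<subseteq> J" "(G <+> Q) \<inter> J \<inter> A1 = {\<zero>}" "(G <+> Q) \<inter> J <+> A1 = J"
      using pris_complement[OF A0 Jp Int_lower2] .
    obtain B1 where B1: "B1 \<in> pris" "B1 \<subseteq> Q" "(G <+> A) \<inter> Q \<inter> B1 = {\<zero>}" "(G <+> A) \<inter> Q <+> B1 = Q"
      using pris_complement[OF B0 Q(1) Int_lower2] .
    have dA: "A1 \<inter> (G <+> Q) = {\<zero>}" and dB: "B1 \<inter> (G <+> A) = {\<zero>}" using A1 B1 by blast+
    have A1A: "A1 \<subseteq> A" using A1(2) JA[OF J] by blast
    have AB1: "A1 \<inter> B1 = {\<zero>}" 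
      using A1A B1(2) AQ pris_zero[OF A1(1)] pris_zero[OF B1(1)] by blast
    \<comment> \<open>Domain and range of \<open>G\<close> have equal dimension, so
      \<open>dim J \<le> dim Q\<close> leaves a remainder \<open>B1\<close> of \<open>Q\<close> at
      least as large as the remainder \<open>A1\<close> of \<open>J\<close>.\<close>
    have "dim J = dim G + dim A1"
      using dim_set_add[OF A0 A1(1,3)] A1(4) dim_graph_domain[OF Jp Q(1) JQ gJ] by simp
    moreover have "dim Q = dim G + dim B1"
      using dim_set_add[OF B0 B1(1,3)] B1(4) dim_graph_domain[OF Q(1) A] AQ graph_sym[OF A Q(1)] g
      by (simp add: Int_commute)
    ultimately have "dim A1 \<le> dim B1" using le[OF J] by simp
    then obtain Y where Y: "graph A1 B1 Y" "A1 \<subseteq> Y <+> B1"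
      using embedding_of_dim_le[OF A1(1) B1(1) AB1] by blast
    have Yp: "Y \<in> pris" "Y \<subseteq> A1 <+> B1" using Y by (auto simp: graph_def)
    have XY: "G <+> Y \<in> pris" "G \<subseteq> G <+> Y" "Y \<subseteq> G <+> Y"
      using pris_set_add[OF Xp(1) Yp(1)] subset_set_add1[OF Xp(1) Yp(1)] subset_set_add2[OF Xp(1) Yp(1)] by auto
    have gXY: "graph A Q (G <+> Y)" 
      by (rule graph_set_add[OF A Q(1) AQ g A1(1) A1A dA B1(1,2) dB Y(1)])
    have JX: "J \<subseteq> (G <+> Y) <+> Q"
    proof -
      have "(G <+> Y) <+> Q \<in> pris" by (rule pris_set_add[OF XY(1) Q(1)])
      moreover have "(G <+> Q) \<inter> J \<subseteq> (G <+> Y) <+> Q" using set_add_mono[OF XY(2), of Q Q] by blast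
      moreover have "A1 \<subseteq> (G <+> Y) <+> Q" using set_add_mono[OF XY(3) B1(2)] Y(2) by blast
      ultimately have "(G <+> Q) \<inter> J <+> A1 \<subseteq> (G <+> Y) <+> Q" by (rule set_add_subset)
      then show ?thesis using A1(4) by simp
    qed
    \<comment> \<open>The extended domain is exactly \<open>J\<close>, hence comparable with every
      member of the chain.\<close>
    have "Y \<subseteq> J <+> Q" using Yp(2) set_add_mono[OF A1(2) B1(2)] by blast
    then have XYJ: "G <+> Y \<subseteq> J <+> Q" using XJ pris_set_add[OF Jp Q(1)] by (intro set_add_subset)
    have "J' \<subseteq> (G <+> Y) <+> Q \<or> G <+> Y \<subseteq> J' <+> Q" if "J' \<in> C" for J'
    proof -
      have "J' \<subseteq> J \<or> J \<subseteq> J'" using C J that by (auto simp: subset_chain_def)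
      then show ?thesis using JX XYJ set_add_mono[of J J' Q Q] by blast
    qed
    then have "G <+> Y \<in> \<Gamma>" using gXY by (simp add: \<Gamma>_def)
    then have "G <+> Y = G" using max XY by blast
    then show False using JX neg by simp
  qed
  \<comment> \<open>The domain is now all of \<open>A\<close>, and the range lies in
    \<open>Q\<close>: the two dimension counts below amount to \<open>dim A \<le> dim G\<close> and
    \<open>dim G \<le> dim Q\<close>.\<close>
  then have "A \<subseteq> G <+> Q" using Join_least[OF Cp XQ] by (simp add: A_def)
  then have "A <+> Q \<subseteq> G <+> Q" using XQ subset_set_add2[OF Xp(1) Q(1)] by (intro set_add_subset)
  then have "dim A + dim Q \<le> dim G + dim Q"
    using dim_mono[OF AQp XQ] dim_set_add[OF A Q(1) AQ] dim_set_add[OF Xp(1) Q(1) Xp(4)] by simp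
  moreover have "G <+> A \<subseteq> A <+> Q" using AQp Xp(2) subset_set_add1[OF A Q(1)] by (intro set_add_subset)
  then have "dim G + dim A \<le> dim A + dim Q"
    using dim_mono[OF XA AQp] dim_set_add[OF A Q(1) AQ] dim_set_add[OF Xp(1) A Xp(3)] by simp
  ultimately show ?thesis by (simp add: A_def)
qed

text \<open>The general case reduces to the previous lemma by passing to the quotient by a small \<open>Q\<close> and
  cutting off a member of the chain whose dimension is close to the supremum.\<close>

lemma dim_Join_chain:
  assumes C: "subset.chain pris C" "C \<noteq> {}" and le: "\<And>J. J \<in> C \<Longrightarrow> dim J \<le> L"
  shows "dim (Join C) \<le> L"
proof (rule ccontr)
  assume neg: "\<not> dim (Join C) \<le> L"
  define G where "G = Join C"
  have Cp: "C \<subseteq> pris" using C by (simp add: subset_chain_def)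
  have G: "G \<in> pris" using Cp by (simp add: G_def Join_in_pris)
  \<comment> \<open>Half the excess allows for two losses of at most \<open>dim Q\<close> each: one
    in passing to the quotient by \<open>Q\<close>, one for the part \<open>F\<close> beyond a
    nearly maximal member of the chain.\<close>
  obtain x where x: "x \<in> carrier R" "x \<noteq> \<zero>" "rk x < (dim G - L) / 2"
    using nondiscrete_small_rank[OF nondiscrete, of "(dim G - L) / 2"] neg by (auto simp: G_def)
  define Q where "Q = pri x"
  have Q: "Q \<in> pris" "dim Q < (dim G - L) / 2" using x by (simp_all add: Q_def dim_pri)
  have "0 < rk x" using x rk_eq_zero[of x] rk_range[of x] by simp
  then have Q0: "0 < dim Q" using x by (simp add: Q_def dim_pri)
  obtain Q' where Q': "Q' \<in> pris" "Q' \<subseteq> carrier R" "Q \<inter> Q' = {\<zero>}" "Q <+> Q' = carrier R"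
    using pris_complement[OF Q(1) carrier_in_pris pris_carrier[OF Q(1)]] .
  \<comment> \<open>\<open>\<pi> J\<close> is a copy of the image of \<open>J\<close> in the
    quotient by \<open>Q\<close>, placed inside the complement \<open>Q'\<close> so as to be
    independent of \<open>Q\<close>.\<close>
  define \<pi> where "\<pi> = (\<lambda>J. Q' \<inter> (Q <+> J))"
  have \<pi>p: "\<pi> J \<in> pris" if "J \<in> pris" for J
    using that Q(1) Q'(1) by (auto simp: \<pi>_def intro: pris_Int pris_set_add)
  have dim_\<pi>: "dim (\<pi> J) = dim (Q <+> J) - dim Q" if J: "J \<in> pris" for J
  proof -
    have QJ: "Q <+> J \<in> pris" by (rule pris_set_add[OF Q(1) J])
    have "(Q <+> Q') \<inter> (Q <+> J) = Q <+> (Q' \<inter> (Q <+> J))"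
      by (rule modular_law[OF Q(1) Q'(1) QJ subset_set_add1[OF Q(1) J]])
    then have "Q <+> J = Q <+> \<pi> J" using Q'(4) pris_carrier[OF QJ] by (auto simp: \<pi>_def)
    moreover have "Q \<inter> \<pi> J = {\<zero>}" 
      using Q'(3) pris_zero[OF \<pi>p[OF J]] pris_zero[OF Q(1)] by (auto simp: \<pi>_def)
    ultimately show ?thesis using dim_set_add[OF Q(1) \<pi>p[OF J]] by simp
  qed
  define C1 where "C1 = \<pi> ` C"
  define G1 where "G1 = \<pi> G"
  have G1: "G1 \<in> pris" using G by (simp add: G1_def \<pi>p)
  have C1p: "C1 \<subseteq> pris" using Cp by (auto simp: C1_def \<pi>p)
  have \<pi>_mono: "\<pi> J \<subseteq> \<pi> K" if "J \<subseteq> K" for J K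
    using set_add_mono[OF subset_refl that, of Q] by (auto simp: \<pi>_def)
  have C1: "subset.chain pris C1"
  proof -
    have "\<pi> J \<subseteq> \<pi> K \<or> \<pi> K \<subseteq> \<pi> J" if "J \<in> C" "K \<in> C" for J K
      using that C(1) \<pi>_mono by (meson subset_chain_def)
    then show ?thesis using C1p by (auto simp: subset_chain_def C1_def)
  qed
  have le1: "dim J \<le> L" if "J \<in> C1" for J
  proof -
    obtain K where K: "K \<in> C" "J = \<pi> K" using \<open>J \<in> C1\<close> by (auto simp: C1_def)
    then have "dim J \<le> dim K" using Cp dim_\<pi>[of K] dim_set_add_le[OF Q(1), of K] by auto
    then show ?thesis using le[OF K(1)] by simp
  qed
  have C1ne: "C1 \<noteq> {}" using C by (simp add: C1_def)
  \<comment> \<open>Adding \<open>Q\<close> commutes with suprema of non-empty families in any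
    lattice; intersecting with \<open>Q'\<close> does so by meet continuity.\<close>
  have "Join ((<+>) Q ` C) = Q <+> G"
  proof (rule Join_unique)
    show "(<+>) Q ` C \<subseteq> pris" using Cp Q(1) by (auto intro: pris_set_add)
    show "Q <+> G \<in> pris" by (rule pris_set_add[OF Q(1) G])
    show "J \<subseteq> Q <+> G" if J: "J \<in> (<+>) Q ` C" for J
    proof -
      obtain K where "K \<in> C" "J = Q <+> K" using J by blast
      then show ?thesis using set_add_mono[OF subset_refl Join_upper[OF Cp]] by (simp add: G_def)
    qed
    fix M assume M: "M \<in> pris" "\<And>J. J \<in> (<+>) Q ` C \<Longrightarrow> J \<subseteq> M"
    have QM: "Q \<subseteq> M" "J \<subseteq> M" if "J \<in> C" for J
      using that Cp M(2)[of "Q <+> J"] subset_set_add1[OF Q(1), of J] subset_set_add2[OF Q(1), of J] by auto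
    then have "G \<subseteq> M" using Join_least[OF Cp M(1)] by (auto simp: G_def)
    moreover have "Q \<subseteq> M" using QM C by blast
    ultimately show "Q <+> G \<subseteq> M" using M(1) by (intro set_add_subset)
  qed
  moreover have "subset.chain pris ((<+>) Q ` C)"
  proof -
    have "Q <+> J \<subseteq> Q <+> K \<or> Q <+> K \<subseteq> Q <+> J" if "J \<in> C" "K \<in> C" for J K
      using that C(1) set_add_mono[OF subset_refl] by (meson subset_chain_def)
    moreover have "(<+>) Q ` C \<subseteq> pris" using Cp Q(1) by (auto intro: pris_set_add)
    ultimately show ?thesis by (auto simp: subset_chain_def)
  qed
  ultimately have JoinC1: "Join C1 = G1"
    using Int_Join_chain[of "(<+>) Q ` C" Q'] Q'(1) by (simp add: C1_def G1_def \<pi>_def image_image)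
  define L1 where "L1 = (SUP J\<in>C1. dim J)"
  have bdd: "bdd_above (dim ` C1)" using le1 by (auto intro!: bdd_aboveI2)
  have "L1 \<le> L" unfolding L1_def using C1ne le1 by (intro cSUP_least)
  \<comment> \<open>A member of \<open>C1\<close> above \<open>I0\<close> exceeds it by less than
    \<open>dim Q\<close>, so the parts lying in a complement \<open>F\<close> of \<open>I0\<close>
    are small enough for the previous lemma.\<close>
  obtain I0 where I0: "I0 \<in> C1" "L1 - dim Q < dim I0"
    using Q0 less_cSUP_iff[OF C1ne bdd, of "L1 - dim Q"] by (auto simp: L1_def)
  have I0p: "I0 \<in> pris" "I0 \<subseteq> G1" using I0 C1p Join_upper[OF C1p] JoinC1 by auto
  obtain F where F: "F \<in> pris" "F \<subseteq> G1" "I0 \<inter> F = {\<zero>}" "I0 <+> F = G1"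
    using pris_complement[OF I0p(1) G1 I0p(2)] .
  define C2 where "C2 = (\<inter>) F ` C1"
  have C2p: "C2 \<subseteq> pris" using C1p F(1) by (auto simp: C2_def intro: pris_Int)
  have C2: "subset.chain pris C2"
  proof -
    have "F \<inter> J \<subseteq> F \<inter> K \<or> F \<inter> K \<subseteq> F \<inter> J" if "J \<in> C1" "K \<in> C1" for J K
      using C1 that unfolding subset_chain_def by blast
    then show ?thesis using C2p by (auto simp: subset_chain_def C2_def)
  qed
  have "Join C2 = F \<inter> G1" using Int_Join_chain[OF C1 F(1)] JoinC1 by (simp add: C2_def)
  then have JoinC2: "Join C2 = F" using F by blast
  have "F \<inter> Q = {\<zero>}" 
    using F(2) Q'(3) pris_zero[OF F(1)] pris_zero[OF Q(1)] by (auto simp: G1_def \<pi>_def)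
  moreover have "dim K \<le> dim Q" if K: "K \<in> C2" for K
  proof -
    obtain J where J: "J \<in> C1" "K = F \<inter> J" using K by (auto simp: C2_def)
    have Jp: "J \<in> pris" using J C1p by blast
    have Kp: "K \<in> pris" using K C2p by blast
    have "J \<subseteq> I0 \<or> I0 \<subseteq> J" using J I0 C1 by (auto simp: subset_chain_def)
    then show ?thesis
    proof
      assume "J \<subseteq> I0"
      then have "K = {\<zero>}" using J F(3) pris_zero[OF Kp] by blast
      then show ?thesis using Q0 by (simp add: dim_zero)
    next
      assume IJ: "I0 \<subseteq> J"
      have "J \<subseteq> G1" using J Join_upper[OF C1p] JoinC1 by blast
      then have "J = (I0 <+> F) \<inter> J" using F(4) by blast
      also have "\<dots> = I0 <+> (F \<inter> J)" by (rule modular_law[OF I0p(1) F(1) Jp IJ])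
      finally have "J = I0 <+> K" using J by simp
      moreover have "I0 \<inter> K = {\<zero>}" using F(3) J pris_zero[OF I0p(1)] pris_zero[OF Kp] by blast
      ultimately have "dim J = dim I0 + dim K" using dim_set_add[OF I0p(1) Kp] by simp
      moreover have "dim J \<le> L1" unfolding L1_def using J bdd by (intro cSUP_upper)
      ultimately show ?thesis using I0 by simp
    qed
  qed
  ultimately have "dim F \<le> dim Q"
    using dim_Join_chain_le[OF C2 Q(1)] JoinC2 by simp
  moreover have "dim I0 + dim F = dim G1" using dim_set_add[OF I0p(1) F(1,3)] F(4) by simp
  moreover have "dim I0 \<le> L" using le1 I0 by blast
  moreover have "dim G1 \<ge> dim G - dim Q"
    using dim_\<pi>[OF G] dim_mono[OF G pris_set_add[OF Q(1) G] subset_set_add2[OF Q(1) G]] by (simp add: G1_def)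
  ultimately show False using Q(2) by simp
qed

end

section \<open>Chains of idempotents\<close>

definition (in ring) idem :: "'a \<Rightarrow> bool" where
  "idem e \<longleftrightarrow> e \<in> carrier R \<and> e \<otimes> e = e"

definition (in ring) idem_le :: "'a \<Rightarrow> 'a \<Rightarrow> bool" (infix \<open>\<preceq>\<close> 50) where
  "e \<preceq> f \<longleftrightarrow> e \<otimes> f = e \<and> f \<otimes> e = e"

context ring
begin

lemma idem_carrier: "idem e \<Longrightarrow> e \<in> carrier R"
  by (simp add: idem_def)

lemma idem_le_refl: "idem e \<Longrightarrow> e \<preceq> e"
  by (simp add: idem_def idem_le_def)

lemma idem_le_trans:
  assumes "idem e" "idem f" "idem g" "e \<preceq> f" "f \<preceq> g" shows "e \<preceq> g"
proof -
  have c: "e \<in> carrier R" "f \<in> carrier R" "g \<in> carrier R" using assms by (auto simp: idem_carrier)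
  have "e \<otimes> g = e \<otimes> (f \<otimes> g)" using assms(4) c by (simp add: idem_le_def flip: m_assoc)
  moreover have "g \<otimes> e = (g \<otimes> f) \<otimes> e" using assms(4) c by (simp add: idem_le_def m_assoc)
  ultimately show ?thesis using assms(4,5) by (simp add: idem_le_def)
qed

lemma idem_one_minus: "idem e \<Longrightarrow> idem (\<one> \<ominus> e)"
  using idem_compl(1) by (auto simp: idem_def)

lemma one_minus_one_minus: "e \<in> carrier R \<Longrightarrow> \<one> \<ominus> (\<one> \<ominus> e) = e"
  by (simp add: minus_eq minus_add a_lcomm r_neg1 flip: a_assoc) (simp add: r_neg)

lemma one_minus_mult_eq_zero: 
  "e \<in> carrier R \<Longrightarrow> x \<in> carrier R \<Longrightarrow> (\<one> \<ominus> e) \<otimes> x = \<zero> \<longleftrightarrow> e \<otimes> x = x"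
  using diff_eq_zero[of x "e \<otimes> x"] by (auto simp: minus_eq l_distr l_minus)

lemma mult_one_minus_eq_zero: 
  "e \<in> carrier R \<Longrightarrow> x \<in> carrier R \<Longrightarrow> x \<otimes> (\<one> \<ominus> e) = \<zero> \<longleftrightarrow> x \<otimes> e = x"
  using diff_eq_zero[of x "x \<otimes> e"] by (auto simp: minus_eq r_distr r_minus)

text \<open>The first condition encodes \<open>fe = e\<close>, an inclusion of images; the second
  encodes \<open>ef = e\<close>, the reverse inclusion of kernels.\<close>

lemma idem_le_iff:
  assumes "idem e" "idem f"
  shows "e \<preceq> f \<longleftrightarrow> e \<in> pri f \<and> \<one> \<ominus> f \<in> pri (\<one> \<ominus> e)"
proof -
  have c: "e \<in> carrier R" "f \<in> carrier R" using assms by (auto simp: idem_carrier)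
  have "\<one> \<ominus> f \<in> pri (\<one> \<ominus> e) \<longleftrightarrow> (\<one> \<ominus> (\<one> \<ominus> e)) \<otimes> (\<one> \<ominus> f) = \<zero>"
    using c idem_one_minus[OF assms(1)] 
    by (subst one_minus_mult_eq_zero) (auto simp: mem_pri_idem idem_def)
  also have "\<dots> \<longleftrightarrow> e \<otimes> f = e" using c by (simp add: one_minus_one_minus mult_one_minus_eq_zero)
  finally show ?thesis using assms by (auto simp: idem_le_def mem_pri_idem idem_def)
qed

lemma idem_le_one_minus:
  assumes "idem e" "idem f" shows "\<one> \<ominus> f \<preceq> \<one> \<ominus> e \<longleftrightarrow> e \<preceq> f"
  using assms by (auto simp: idem_le_iff idem_one_minus idem_carrier one_minus_one_minus)

lemma idem_diff:
  assumes "idem e" "idem f" "e \<preceq> f"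
  shows "idem (f \<ominus> e)" "e \<otimes> (f \<ominus> e) = \<zero>" "(f \<ominus> e) \<otimes> e = \<zero>" "e \<oplus> (f \<ominus> e) = f"
proof -
  have c: "e \<in> carrier R" "f \<in> carrier R" using assms by (auto simp: idem_carrier)
  show "e \<otimes> (f \<ominus> e) = \<zero>" "(f \<ominus> e) \<otimes> e = \<zero>" "e \<oplus> (f \<ominus> e) = f"
    using assms c by (auto simp: idem_def idem_le_def minus_eq l_distr r_distr l_minus r_minus r_neg a_lcomm[of e])
  then show "idem (f \<ominus> e)"
    using assms c by (auto simp: idem_def idem_le_def minus_eq l_distr r_distr l_minus r_minus r_neg)
qed

end

text \<open>\<open>W\<close> is the direct sum of \<open>gR\<close> and its intersection with the
  kernel of \<open>g\<close>. What has to be arranged is a projection onto the second summand whose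
  kernel contains \<open>gR\<close> and \<open>(1 - h)R\<close>.\<close>

lemma (in regular_ring) idem_between:
  assumes "idem g" "idem h" "g \<preceq> h" "W \<in> pris" "pri g \<subseteq> W" "W \<subseteq> pri h"
  obtains u where "idem u" "pri u = W" "g \<preceq> u" "u \<preceq> h"
proof -
  have c: "g \<in> carrier R" "h \<in> carrier R" and gg: "g \<otimes> g = g" and hh: "h \<otimes> h = h" 
    and gh: "g \<otimes> h = g" "h \<otimes> g = g"
    using assms by (auto simp: idem_def idem_le_def)
  have "W \<inter> {y \<in> carrier R. g \<otimes> y = \<zero>} \<in> pris" 
    using assms(4) c by (intro pris_Int annihilator_in_pris)
  then obtain w where w: "w \<in> carrier R" "w \<otimes> w = w" "W \<inter> {y \<in> carrier R. g \<otimes> y = \<zero>} = pri w"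
    by (rule pris_idem)
  have wW: "w \<in> W" and gw: "g \<otimes> w = \<zero>" using generator_mem_pri[OF w(1)] w(3) by auto
  have hw: "h \<otimes> w = w" using wW assms(6) mem_pri_idem[OF c(2) hh] by auto
  \<comment> \<open>The factor \<open>h - g\<close> annihilates \<open>gR\<close> and
    \<open>(1 - h)R\<close> and fixes \<open>k\<close>, so \<open>k\<close> gets the required kernel
    and stays idempotent.\<close>
  define k where "k = w \<otimes> (h \<ominus> g)"
  have kc: "k \<in> carrier R" using w c by (simp add: k_def)
  have diff: "(h \<ominus> g) \<otimes> y = h \<otimes> y \<ominus> g \<otimes> y" "y \<otimes> (h \<ominus> g) = y \<otimes> h \<ominus> y \<otimes> g" if "y \<in> carrier R" for y
    using that c by (auto simp: minus_eq l_distr r_distr l_minus r_minus)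
  have k: "k \<otimes> y = w \<otimes> ((h \<ominus> g) \<otimes> y)" if "y \<in> carrier R" for y
    using that w c by (simp add: k_def m_assoc)
  have gk: "g \<otimes> k = \<zero>" and hk: "h \<otimes> k = k" using gw hw w c by (simp_all add: k_def flip: m_assoc)
  have kg: "k \<otimes> g = \<zero>" using k[OF c(1)] w c gg gh by (simp add: minus_eq l_distr l_minus r_neg)
  have "k \<otimes> h = w \<otimes> (h \<ominus> g)" using k[OF c(2)] w c hh gh diff(1)[OF c(2)] by simp
  then have kh: "k \<otimes> h = k" by (simp add: k_def)
  have "(h \<ominus> g) \<otimes> k = k" using diff(1)[OF kc] kc gk hk by (simp add: minus_eq)
  moreover have "w \<otimes> k = k" using w c by (simp add: k_def flip: m_assoc)
  ultimately have kk: "k \<otimes> k = k" using k[OF kc] by simp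
  define u where "u = g \<oplus> k"
  have uc: "u \<in> carrier R" using c kc by (simp add: u_def)
  have gu: "g \<otimes> u = g" "u \<otimes> g = g" and hu: "h \<otimes> u = u" "u \<otimes> h = u" and uu: "u \<otimes> u = u"
    using c kc gg gk kg kk gh hk kh by (simp_all add: u_def l_distr r_distr)
  have "k \<in> W" 
    using pri_mult_mem[of "h \<ominus> g" w] w c by (auto simp: k_def)
  moreover have "g \<in> W" using assms(5) c generator_mem_pri by blast
  ultimately have "u \<in> W" using assms(4) by (simp add: u_def pris_add)
  then have "pri u \<subseteq> W" using assms(4) uc by (simp add: pri_subset_iff)
  moreover have "W \<subseteq> pri u"
  proof
    fix y assume y: "y \<in> W"
    then have yc: "y \<in> carrier R" and hy: "h \<otimes> y = y" 
      using assms(4,6) mem_pri_idem[OF c(2) hh] by (auto intro: pris_mem_carrier)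
    define z where "z = y \<ominus> g \<otimes> y"
    have zc: "z \<in> carrier R" using yc c by (simp add: z_def)
    have "g \<otimes> y \<in> W" using assms(5) c yc pri_mult_mem by blast
    then have "z \<in> W" using y assms(4) by (simp add: z_def pris_diff)
    moreover have gz: "g \<otimes> z = \<zero>" using c yc gg by (simp add: z_def minus_eq r_distr r_minus r_neg flip: m_assoc)
    ultimately have "z \<in> pri w" using w(3) zc by blast
    then have wz: "w \<otimes> z = z" using w mem_pri_idem by blast
    have "h \<otimes> z = z" using c yc hy gh by (simp add: z_def minus_eq r_distr r_minus flip: m_assoc)
    then have "k \<otimes> z = z" using k[OF zc] diff(1)[OF zc] gz wz zc by (simp add: minus_eq)
    then have "u \<otimes> z = z" using gz zc c kc by (simp add: u_def l_distr)
    moreover have "u \<otimes> (g \<otimes> y) = g \<otimes> y" using gu c yc uc by (simp flip: m_assoc)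
    moreover have "y = g \<otimes> y \<oplus> z" using c yc by (simp add: z_def minus_eq a_lcomm[of "g \<otimes> y"] r_neg)
    ultimately have "u \<otimes> y = y" using uc c yc zc by (metis m_closed r_distr)
    then show "y \<in> pri u" using mem_pri_idem[OF uc uu] yc by blast
  qed
  ultimately show ?thesis using that[of u] uc uu gu hu by (auto simp: idem_def idem_le_def)
qed

context ranked_ring
begin

lemma rk_idem_diff:
  assumes "idem e" "idem f" "e \<preceq> f" shows "rk (f \<ominus> e) = rk f - rk e"
  using rk_orthogonal_add[of e "f \<ominus> e"] idem_diff[OF assms] assms by (auto simp: idem_def)

lemma rk_idem_mono:
  assumes "idem e" "idem f" "e \<preceq> f" shows "rk e \<le> rk f"
  using rk_idem_diff[OF assms] rk_range[of "f \<ominus> e"] assms by (simp add: idem_carrier)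

lemma idem_le_rk_eq:
  assumes "idem e" "idem f" "e \<preceq> f" "rk f \<le> rk e" shows "e = f"
proof -
  have "rk (f \<ominus> e) = 0" using rk_idem_diff[OF assms(1-3)] rk_idem_mono[OF assms(1-3)] assms(4) by simp
  then show ?thesis using rk_eq_zero[of "f \<ominus> e"] assms(1,2) diff_eq_zero[of f e] by (simp add: idem_carrier)
qed

lemma rk_one_minus: "idem e \<Longrightarrow> rk (\<one> \<ominus> e) = 1 - rk e"
  using rk_idem_diff[of e \<one>] by (simp add: idem_def idem_le_def rk_one)

end

text \<open>The supremum is taken simultaneously for the images \<open>eR\<close> and, as an infimum, for the
  kernels \<open>(\<one> \<ominus> e)R\<close>; the two continuity axioms make the results complementary.\<close>

lemma (in continuous_ring) idem_chain_sup:
  assumes ne: "C \<noteq> {}" and idem: "\<And>e. e \<in> C \<Longrightarrow> idem e"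
    and chain: "\<And>e f. e \<in> C \<Longrightarrow> f \<in> C \<Longrightarrow> e \<preceq> f \<or> f \<preceq> e"
  obtains g where "idem g" "pri g = Join (pri ` C)" "pri (\<one> \<ominus> g) = \<Inter>((\<lambda>e. pri (\<one> \<ominus> e)) ` C)"
proof -
  define I where "I = Join (pri ` C)"
  define D where "D = (\<lambda>e. pri (\<one> \<ominus> e)) ` C"
  define J where "J = \<Inter>D"
  have c: "e \<in> carrier R" if "e \<in> C" for e using idem[OF that] by (rule idem_carrier)
  have Cp: "pri ` C \<subseteq> pris" and Dp: "D \<subseteq> pris" using c by (auto simp: D_def)
  have le: "pri e \<subseteq> pri f \<and> pri (\<one> \<ominus> f) \<subseteq> pri (\<one> \<ominus> e)" if "e \<in> C" "f \<in> C" "e \<preceq> f" for e f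
    using that idem_le_iff[OF idem idem, of e f] c by (simp add: pri_subset_iff)
  have Cc: "subset.chain pris (pri ` C)"
  proof -
    have "pri e \<subseteq> pri f \<or> pri f \<subseteq> pri e" if "e \<in> C" "f \<in> C" for e f
      using chain[OF that] le that by blast
    then show ?thesis using Cp by (auto simp: subset_chain_def)
  qed
  have Dc: "subset.chain pris D"
  proof -
    have "pri (\<one> \<ominus> e) \<subseteq> pri (\<one> \<ominus> f) \<or> pri (\<one> \<ominus> f) \<subseteq> pri (\<one> \<ominus> e)" if "e \<in> C" "f \<in> C" for e f
      using chain[OF that] le that by blast
    then show ?thesis using Dp by (auto simp: subset_chain_def D_def)
  qed
  have Ip: "I \<in> pris" using Cp by (simp add: I_def Join_in_pris)
  have Dne: "D \<noteq> {}" using ne by (simp add: D_def)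
  have Jp: "J \<in> pris" using Dp Dne by (simp add: J_def Inter_in_pris)
  have "J \<inter> pri e = {\<zero>}" if e: "e \<in> C" for e
  proof -
    have "x = \<zero>" if "x \<in> pri (\<one> \<ominus> e)" "x \<in> pri e" for x
    proof -
      have "e \<otimes> x = x" "(\<one> \<ominus> e) \<otimes> x = x" "x \<in> carrier R"
        using that idem[OF e] idem_one_minus[OF idem[OF e]] by (auto simp: mem_pri_idem idem_def)
      then show ?thesis using one_minus_mult_eq_zero[OF c[OF e], of x] by simp
    qed
    moreover have "J \<subseteq> pri (\<one> \<ominus> e)" using e by (auto simp: J_def D_def)
    ultimately show ?thesis using pris_zero[OF Jp] pris_zero[OF pri_in_pris[OF c[OF e]]] by blast
  qed
  then have "(\<inter>) J ` pri ` C = (\<lambda>e. {\<zero>}) ` C" unfolding image_image by (rule image_cong[OF refl])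
  then have eq: "(\<inter>) J ` pri ` C = {{\<zero>}}" using ne by (simp add: image_constant_conv)
  have "J \<inter> I = Join {{\<zero>}}" using Int_Join_chain[OF Cc Jp] by (simp only: I_def eq)
  also have "\<dots> = {\<zero>}" by (rule Join_unique) (auto simp: zero_in_pris)
  finally have IJ: "I \<inter> J = {\<zero>}" by blast
  have "I <+> K = carrier R" if K: "K \<in> D" for K
  proof -
    obtain e where e: "e \<in> C" "K = pri (\<one> \<ominus> e)" using K by (auto simp: D_def)
    have "e \<in> I" using generator_mem_pri[OF c[OF e(1)]] Join_upper[OF Cp] e(1) by (auto simp: I_def)
    moreover have "\<one> \<ominus> e \<in> K" using c[OF e(1)] e(2) generator_mem_pri by simp
    moreover have "\<one> = e \<oplus> (\<one> \<ominus> e)" using c[OF e(1)] by (simp add: minus_eq a_lcomm[of e] r_neg)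
    ultimately have "\<one> \<in> I <+> K" unfolding mem_set_add by blast
    moreover have "I <+> K \<in> pris" using K Dp Ip by (auto intro: pris_set_add)
    ultimately show ?thesis using pri_subset_iff[of "I <+> K" \<one>] pris_carrier by auto
  qed
  then have "(\<lambda>K. I <+> K) ` D = (\<lambda>K. carrier R) ` D" by (rule image_cong[OF refl])
  then have "(\<lambda>K. I <+> K) ` D = {carrier R}" using Dne by (simp add: image_constant_conv)
  then have "I <+> J = pri \<one>" using set_add_Inter_chain[OF Dc Dne Ip] by (simp add: J_def)
  then obtain g f where gf: "g \<in> carrier R" "f \<in> carrier R" "g \<otimes> g = g" "I = pri g" "J = pri f" "\<one> = g \<oplus> f"
    using disjoint_orthogonal_idems[OF Ip Jp IJ one_closed l_one[OF one_closed]] by blast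
  have "f = \<one> \<ominus> g" using gf(1,2,6) diff_cancel(1) by simp
  then show ?thesis using that[of g] gf by (simp add: idem_def I_def J_def D_def)
qed

section \<open>Chains of invariant idempotents\<close>

context nondiscrete_irreducible_ring
begin

text \<open>The hypothesis \<open>cyclic\<close> bounds the rank of the \<open>x\<close>-invariant right ideals generated by one
  element. It makes a maximal chain of \<open>x\<close>-invariant idempotents free of jumps.\<close>

lemma invariant_idem_chain:
  assumes x: "x \<in> carrier R" and e0: "idem e0" "e0 \<otimes> (x \<otimes> e0) = x \<otimes> e0"
    and cyclic: "\<And>v. v \<in> carrier R \<Longrightarrow> \<exists>U\<in>pris. v \<in> U \<and> (\<forall>y\<in>U. x \<otimes> y \<in> U) \<and> dim U \<le> N * rk v \<and>
      (\<forall>K\<in>pris. v \<in> K \<longrightarrow> (\<forall>y\<in>K. x \<otimes> y \<in> K) \<longrightarrow> U \<subseteq> K)"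
    and N: "0 \<le> N"
  obtains E where "\<And>e. e \<in> E \<Longrightarrow> idem e \<and> e0 \<preceq> e \<and> e \<otimes> (x \<otimes> e) = x \<otimes> e"
    "\<And>e f. e \<in> E \<Longrightarrow> f \<in> E \<Longrightarrow> e \<preceq> f \<or> f \<preceq> e"
    "\<And>s. rk e0 \<le> s \<Longrightarrow> s \<le> 1 \<Longrightarrow> \<exists>e\<in>E. rk e = s"
proof -
  define P where "P = {e. idem e \<and> e0 \<preceq> e \<and> e \<otimes> (x \<otimes> e) = x \<otimes> e}"
  define \<C> where "\<C> = {E. E \<subseteq> P \<and> (\<forall>e\<in>E. \<forall>f\<in>E. e \<preceq> f \<or> f \<preceq> e)}"
  have "\<exists>E\<in>\<C>. \<forall>F\<in>\<C>. E \<subseteq> F \<longrightarrow> F = E"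
  proof (rule subset_Zorn')
    fix \<K> assume K: "subset.chain \<C> \<K>"
    have "e \<preceq> f \<or> f \<preceq> e" if ef: "e \<in> E" "f \<in> F" "E \<in> \<K>" "F \<in> \<K>" for e f E F
    proof -
      have "E \<subseteq> F \<or> F \<subseteq> E" using K ef by (auto simp: subset_chain_def)
      moreover have "E \<in> \<C>" "F \<in> \<C>" using K ef by (auto simp: subset_chain_def)
      ultimately show ?thesis using ef(1,2) unfolding \<C>_def by blast
    qed
    moreover have "\<Union>\<K> \<subseteq> P" using K by (auto simp: subset_chain_def \<C>_def)
    ultimately show "\<Union>\<K> \<in> \<C>" unfolding \<C>_def by blast
  qed
  then obtain E where E: "E \<in> \<C>" and max: "\<And>F. F \<in> \<C> \<Longrightarrow> E \<subseteq> F \<Longrightarrow> F = E" by blast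
  have EP: "idem e" "e0 \<preceq> e" "e \<otimes> (x \<otimes> e) = x \<otimes> e" "e \<in> carrier R" if "e \<in> E" for e 
    using E that by (auto simp: \<C>_def P_def idem_def)
  have chain: "e \<preceq> f \<or> f \<preceq> e" if "e \<in> E" "f \<in> E" for e f using E that by (auto simp: \<C>_def)
  have mem_E: "g \<in> E" if "idem g" "e0 \<preceq> g" "g \<otimes> (x \<otimes> g) = x \<otimes> g" "\<And>f. f \<in> E \<Longrightarrow> g \<preceq> f \<or> f \<preceq> g" for g
  proof -
    have "insert g E \<in> \<C>"
      using E that idem_le_refl[OF that(1)] unfolding \<C>_def P_def by blast
    then show ?thesis using max[of "insert g E"] by blast
  qed
  have e0E: "e0 \<in> E" using e0 EP(2) by (intro mem_E idem_le_refl) auto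
  have oneE: "\<one> \<in> E"
    using EP(4) x e0(1) by (intro mem_E) (auto simp: idem_def idem_le_def)
  have "\<exists>e\<in>E. rk e = s" if s: "rk e0 \<le> s" "s \<le> 1" for s
  proof (rule ccontr)
    assume no: "\<not> ?thesis"
    \<comment> \<open>The missing rank \<open>s\<close> cuts \<open>E\<close> into a lower and an
      upper part. The upper part is recorded by complements: its infimum then comes from a supremum,
      to which the continuity of the rank applies.\<close>
    define C where "C = {e \<in> E. rk e \<le> s}"
    define C' where "C' = (\<lambda>f. \<one> \<ominus> f) ` {f \<in> E. s \<le> rk f}"
    have CC': "e \<preceq> f" if "e \<in> C" "f \<in> E" "s \<le> rk f" for e f
    proof -
      have e: "e \<in> E" "rk e \<le> s" using that by (auto simp: C_def)
      show ?thesis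
      proof (cases "e \<preceq> f")
        case False
        then have fe: "f \<preceq> e" using chain[OF e(1) that(2)] by blast
        then have "f = e" using idem_le_rk_eq[OF EP(1)[OF that(2)] EP(1)[OF e(1)]] e that by simp
        then show ?thesis using fe by simp
      qed
    qed
    have Cne: "C \<noteq> {}" using e0E s by (auto simp: C_def)
    have Cidem: "idem e" "e \<in> E" if "e \<in> C" for e using that EP by (auto simp: C_def)
    obtain g where g: "idem g" "pri g = Join (pri ` C)" "pri (\<one> \<ominus> g) = \<Inter>((\<lambda>e. pri (\<one> \<ominus> e)) ` C)"
      by (rule idem_chain_sup[OF Cne]) (use Cidem chain in auto)
    have gc: "g \<in> carrier R" using g by (simp add: idem_carrier)
    have Cp: "pri ` C \<subseteq> pris" using Cidem idem_carrier by auto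
    have g_upper: "e \<preceq> g" if e: "e \<in> C" for e
    proof -
      have "pri e \<subseteq> pri g" using Join_upper[OF Cp] e g(2) by auto
      moreover have "pri (\<one> \<ominus> g) \<subseteq> pri (\<one> \<ominus> e)" using e g(3) by auto
      ultimately show ?thesis
        using idem_le_iff[OF Cidem(1)[OF e] g(1)] gc idem_carrier[OF Cidem(1)[OF e]] generator_mem_pri by blast
    qed
    have g_least: "g \<preceq> f" if f: "idem f" "\<And>e. e \<in> C \<Longrightarrow> e \<preceq> f" for f
    proof -
      have *: "pri e \<subseteq> pri f \<and> \<one> \<ominus> f \<in> pri (\<one> \<ominus> e)" if "e \<in> C" for e
        using f(2)[OF that] idem_le_iff[OF Cidem(1)[OF that] f(1)] idem_carrier[OF f(1)]
          idem_carrier[OF Cidem(1)[OF that]] by (simp add: pri_subset_iff)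
      then have "Join (pri ` C) \<subseteq> pri f" 
        using Join_least[OF Cp pri_in_pris[OF idem_carrier[OF f(1)]]] by blast
      then have "g \<in> pri f" using g(2) generator_mem_pri[OF gc] by blast
      moreover have "\<one> \<ominus> f \<in> pri (\<one> \<ominus> g)" using * g(3) by auto
      ultimately show ?thesis using idem_le_iff[OF g(1) f(1)] by blast
    qed
    have Cc: "subset.chain pris (pri ` C)"
    proof -
      have "pri e \<subseteq> pri f \<or> pri f \<subseteq> pri e" if "e \<in> C" "f \<in> C" for e f
        using chain[OF Cidem(2)[OF that(1)] Cidem(2)[OF that(2)]]
          idem_le_iff[OF Cidem(1)[OF that(1)] Cidem(1)[OF that(2)]] 
          idem_le_iff[OF Cidem(1)[OF that(2)] Cidem(1)[OF that(1)]] 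
          EP(4)[OF Cidem(2)[OF that(1)]] EP(4)[OF Cidem(2)[OF that(2)]]
        by (auto simp: pri_subset_iff)
      then show ?thesis using Cp by (auto simp: subset_chain_def)
    qed
    have "dim (Join (pri ` C)) \<le> s"
      using Cne EP(4) by (intro dim_Join_chain[OF Cc]) (auto simp: C_def dim_pri)
    then have "rk g \<le> s" using g(2) gc dim_pri[of g] by simp
    \<comment> \<open>The \<open>y\<close> with \<open>xy\<close> in \<open>gR\<close> form a
      principal right ideal, the annihilator of \<open>(1 - g)x\<close>. It contains
      \<open>eR\<close> for every \<open>e\<close> in \<open>C\<close>, hence also the supremum
      \<open>gR\<close>.\<close>
    have "{y \<in> carrier R. ((\<one> \<ominus> g) \<otimes> x) \<otimes> y = \<zero>} \<in> pris"
      using gc x by (intro annihilator_in_pris) simp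
    moreover have "pri e \<subseteq> {y \<in> carrier R. ((\<one> \<ominus> g) \<otimes> x) \<otimes> y = \<zero>}" if e: "e \<in> C" for e
    proof -
      have ec: "e \<in> carrier R" using EP(4) Cidem(2)[OF e] by blast
      have "(\<one> \<ominus> g) \<otimes> e = \<zero>" 
        using g_upper[OF e] one_minus_mult_eq_zero[OF gc ec] by (simp add: idem_le_def)
      then have "(\<one> \<ominus> g) \<otimes> (e \<otimes> (x \<otimes> e)) = \<zero>" using ec gc x by (simp flip: m_assoc)
      then have "(\<one> \<ominus> g) \<otimes> x \<otimes> e = \<zero>" 
        using EP(3)[OF Cidem(2)[OF e]] ec gc x by (simp add: m_assoc)
      then have "e \<in> {y \<in> carrier R. ((\<one> \<ominus> g) \<otimes> x) \<otimes> y = \<zero>}" using ec by blast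
      then show ?thesis
        using ec gc x annihilator_in_pris[of "(\<one> \<ominus> g) \<otimes> x"] by (simp add: pri_subset_iff)
    qed
    ultimately have "Join (pri ` C) \<subseteq> {y \<in> carrier R. ((\<one> \<ominus> g) \<otimes> x) \<otimes> y = \<zero>}"
      using Cp by (intro Join_least) auto
    then have "(\<one> \<ominus> g) \<otimes> x \<otimes> g = \<zero>" using generator_mem_pri[OF gc] g(2) by blast
    then have g_inv: "g \<otimes> (x \<otimes> g) = x \<otimes> g"
      using one_minus_mult_eq_zero[OF gc, of "x \<otimes> g"] gc x by (simp add: m_assoc)
    have gE: "g \<in> E"
    proof (rule mem_E[OF g(1) _ g_inv])
      show "e0 \<preceq> g" using g_upper e0E s by (auto simp: C_def)
      show "g \<preceq> f \<or> f \<preceq> g" if "f \<in> E" for f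
        using that g_upper[of f] g_least[OF EP(1)[OF that]] CC' by (cases "rk f \<le> s") (auto simp: C_def)
    qed
    have C'ne: "C' \<noteq> {}" using oneE s by (auto simp: C'_def rk_one)
    have C'idem: "idem k" if "k \<in> C'" for k using that EP(1) by (auto simp: C'_def idem_one_minus)
    have C'chain: "k \<preceq> l \<or> l \<preceq> k" if kl: "k \<in> C'" "l \<in> C'" for k l
    proof -
      obtain e f where ef: "e \<in> E" "f \<in> E" "k = \<one> \<ominus> e" "l = \<one> \<ominus> f"
        using kl unfolding C'_def by blast
      then show ?thesis using chain[OF ef(1,2)] EP(1)[OF ef(1)] EP(1)[OF ef(2)] by (auto simp: idem_le_one_minus)
    qed
    obtain k where k: "idem k" "pri k = Join (pri ` C')" "pri (\<one> \<ominus> k) = \<Inter>((\<lambda>e. pri (\<one> \<ominus> e)) ` C')"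
      by (rule idem_chain_sup[OF C'ne C'idem C'chain])
    have kc: "k \<in> carrier R" using k by (simp add: idem_carrier)
    define h where "h = \<one> \<ominus> k"
    have h: "idem h" "h \<in> carrier R" "\<one> \<ominus> h = k"
      using k(1) kc by (auto simp: h_def idem_one_minus one_minus_one_minus)
    have pri_h: "pri h = \<Inter>(pri ` {f \<in> E. s \<le> rk f})"
      using k(3) EP(4) by (simp add: h_def C'_def image_image one_minus_one_minus cong: image_cong_simp)
    have C'p: "pri ` C' \<subseteq> pris" using EP(4) by (auto simp: C'_def)
    have h_lower: "h \<preceq> f" if f: "f \<in> E" "s \<le> rk f" for f
    proof -
      have "h \<in> pri f" using pri_h f generator_mem_pri[OF h(2)] by blast
      moreover have "\<one> \<ominus> f \<in> pri (\<one> \<ominus> h)"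
        using Join_upper[OF C'p] f k(2) generator_mem_pri[of "\<one> \<ominus> f"] EP(4)[OF f(1)] h(3) 
        by (auto simp: C'_def)
      ultimately show ?thesis using idem_le_iff[OF h(1) EP(1)[OF f(1)]] by blast
    qed
    have gh: "g \<preceq> h"
    proof -
      have gf: "g \<preceq> f" if "f \<in> E" "s \<le> rk f" for f
        using g_least[OF EP(1)[OF that(1)]] CC' that by blast
      then have "g \<in> pri h" 
        using pri_h idem_le_iff[OF g(1) EP(1)] by auto
      moreover have "Join (pri ` C') \<subseteq> pri (\<one> \<ominus> g)"
      proof (rule Join_least[OF C'p])
        show "pri (\<one> \<ominus> g) \<in> pris" using gc by simp
        show "J \<subseteq> pri (\<one> \<ominus> g)" if J: "J \<in> pri ` C'" for J
        proof -
          obtain f where f: "f \<in> E" "s \<le> rk f" "J = pri (\<one> \<ominus> f)" using J unfolding C'_def by blast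
          then have "\<one> \<ominus> f \<in> pri (\<one> \<ominus> g)" using gf idem_le_iff[OF g(1) EP(1)] by blast
          then show ?thesis using f EP(4)[OF f(1)] gc by (simp add: pri_subset_iff)
        qed
      qed
      then have "\<one> \<ominus> h \<in> pri (\<one> \<ominus> g)" using k(2) h(3) generator_mem_pri[OF kc] by auto
      ultimately show ?thesis using idem_le_iff[OF g(1) h(1)] by blast
    qed
    have C'c: "subset.chain pris (pri ` C')"
    proof -
      have "pri e \<subseteq> pri f \<or> pri f \<subseteq> pri e" if "e \<in> C'" "f \<in> C'" for e f
        using C'chain[OF that] idem_le_iff[OF C'idem[OF that(1)] C'idem[OF that(2)]]
          idem_le_iff[OF C'idem[OF that(2)] C'idem[OF that(1)]]
          idem_carrier[OF C'idem[OF that(1)]] idem_carrier[OF C'idem[OF that(2)]]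
        by (auto simp: pri_subset_iff)
      then show ?thesis using C'p by (auto simp: subset_chain_def)
    qed
    have "dim (Join (pri ` C')) \<le> 1 - s"
      using C'ne EP by (intro dim_Join_chain[OF C'c]) (auto simp: C'_def dim_pri rk_one_minus)
    then have "rk k \<le> 1 - s" using k(2) kc dim_pri[of k] by simp
    then have rk_h: "s \<le> rk h" using k(1) by (simp add: h_def rk_one_minus)
    \<comment> \<open>Invariance passes to the infimum because \<open>hR\<close> is the intersection
      of the \<open>fR\<close>.\<close>
    have "x \<otimes> h \<in> pri f" if f: "f \<in> E" "s \<le> rk f" for f
    proof -
      have fc: "f \<in> carrier R" using EP(4) f by blast
      have "x \<otimes> h = x \<otimes> (f \<otimes> h)" using h_lower[OF f] by (simp add: idem_le_def)
      also have "\<dots> = f \<otimes> (x \<otimes> f) \<otimes> h" using EP(3)[OF f(1)] x fc h(2) by (simp add: m_assoc)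
      also have "\<dots> = f \<otimes> (x \<otimes> f \<otimes> h)" using x fc h(2) by (simp add: m_assoc)
      finally show ?thesis using pri_mult_mem[of "x \<otimes> f \<otimes> h" f] x fc h(2) by simp
    qed
    then have "x \<otimes> h \<in> pri h" unfolding pri_h by simp
    then have h_inv: "h \<otimes> (x \<otimes> h) = x \<otimes> h" using h(1) mem_pri_idem by (auto simp: idem_def)
    have "rk g < s" using no gE \<open>rk g \<le> s\<close> by force
    define d where "d = h \<ominus> g"
    have d: "idem d" "d \<noteq> \<zero>" "g \<otimes> d = \<zero>"
      using idem_diff[OF g(1) h(1) gh] \<open>rk g < s\<close> rk_h diff_eq_zero[OF h(2) gc] by (auto simp: d_def)
    have dc: "d \<in> carrier R" using d by (simp add: idem_carrier)
    have hd: "h \<otimes> d = d" using gh h(1) gc by (simp add: d_def minus_eq r_distr r_minus idem_def idem_le_def)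
    \<comment> \<open>The aim is \<open>N * rk v < s - rk g\<close>; the denominator
      \<open>N + 1\<close> also covers \<open>N = 0\<close>.\<close>
    define \<epsilon> where "\<epsilon> = (s - rk g) / (N + 1)"
    have "0 < \<epsilon>" using \<open>rk g < s\<close> N by (simp add: \<epsilon>_def)
    then obtain a where a: "a \<in> carrier R" "a \<noteq> \<zero>" "rk a < \<epsilon>"
      using nondiscrete_small_rank[OF nondiscrete] by blast
    \<comment> \<open>Primeness moves the small element into the gap: \<open>v = dra\<close> is
      non-zero, lies in \<open>dR\<close> and has rank at most \<open>rk a\<close>.\<close>
    obtain r where r: "r \<in> carrier R" "d \<otimes> r \<otimes> a \<noteq> \<zero>" using prime_ring[OF a(1) dc a(2) d(2)] .
    define v where "v = d \<otimes> r \<otimes> a"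
    have v: "v \<in> carrier R" "v \<noteq> \<zero>" using r a dc by (auto simp: v_def)
    have gv: "g \<otimes> v = \<zero>" and hv: "h \<otimes> v = v"
      using r a dc gc h(2) hd d(3) by (simp_all add: v_def flip: m_assoc)
    have "rk v < \<epsilon>" using rk_mult(2)[of "d \<otimes> r" a] r a dc by (simp add: v_def)
    then have "(N + 1) * rk v < s - rk g" using N by (simp add: \<epsilon>_def field_simps)
    then have rk_v: "N * rk v < s - rk g" using rk_range[OF v(1)] by (simp add: distrib_right)
    obtain U where U: "U \<in> pris" "v \<in> U" "\<forall>y\<in>U. x \<otimes> y \<in> U" "dim U \<le> N * rk v"
      "\<forall>K\<in>pris. v \<in> K \<longrightarrow> (\<forall>y\<in>K. x \<otimes> y \<in> K) \<longrightarrow> U \<subseteq> K"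
      using cyclic[OF v(1)] by (elim bexE conjE)
    have inv: "x \<otimes> y \<in> pri q" if q: "idem q" "q \<otimes> (x \<otimes> q) = x \<otimes> q" "y \<in> pri q" for q y
    proof -
      have qc: "q \<in> carrier R" "q \<otimes> y = y" "y \<in> carrier R" using q mem_pri_idem by (auto simp: idem_def)
      have "x \<otimes> y = x \<otimes> (q \<otimes> y)" by (simp only: qc)
      also have "\<dots> = q \<otimes> (x \<otimes> q) \<otimes> y" using q(2) qc x by (simp add: m_assoc)
      also have "\<dots> = q \<otimes> (x \<otimes> q \<otimes> y)" using qc x by (simp add: m_assoc)
      finally show ?thesis using pri_mult_mem[of "x \<otimes> q \<otimes> y" q] qc x by simp
    qed
    have "v \<in> pri h" using h(1) hv v mem_pri_idem by (auto simp: idem_def)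
    \<comment> \<open>Leastness of \<open>U\<close> enters here: \<open>hR\<close> is invariant and
      contains \<open>v\<close>.\<close>
    then have Uh: "U \<subseteq> pri h" using U(5) inv[OF h(1) h_inv] h(2) by simp
    define W where "W = pri g <+> U"
    have gp: "pri g \<in> pris" using gc by simp
    have W: "W \<in> pris" "pri g \<subseteq> W" "U \<subseteq> W"
      using pris_set_add[OF gp U(1)] subset_set_add1[OF gp U(1)] subset_set_add2[OF gp U(1)] by (auto simp: W_def)
    have "pri g \<subseteq> pri h" using gh idem_le_iff[OF g(1) h(1)] gc h(2) by (simp add: pri_subset_iff)
    then have "W \<subseteq> pri h" unfolding W_def using Uh h(2) by (intro set_add_subset) auto
    then obtain u where u: "idem u" "pri u = W" "g \<preceq> u" "u \<preceq> h"
      using idem_between[OF g(1) h(1) gh W(1,2)] by blast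
    have uc: "u \<in> carrier R" using u by (simp add: idem_carrier)
    have W_inv: "x \<otimes> y \<in> W" if y: "y \<in> W" for y
    proof -
      obtain a b where ab: "a \<in> pri g" "b \<in> U" "y = a \<oplus> b" using y unfolding W_def mem_set_add by blast
      have "x \<otimes> y = x \<otimes> a \<oplus> x \<otimes> b"
        using ab x pris_mem_carrier[OF gp] pris_mem_carrier[OF U(1)] by (simp add: r_distr)
      then show ?thesis using inv[OF g(1) g_inv ab(1)] bspec[OF U(3) ab(2)] unfolding W_def mem_set_add by blast
    qed
    have "u \<in> W" using u(2) generator_mem_pri[OF uc] by simp
    then have "x \<otimes> u \<in> pri u" using W_inv u(2) by blast
    then have u_inv: "u \<otimes> (x \<otimes> u) = x \<otimes> u" using u(1) mem_pri_idem by (auto simp: idem_def)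
    have "u \<in> E"
    proof (rule mem_E[OF u(1) _ u_inv])
      show "e0 \<preceq> u" using idem_le_trans[OF e0(1) g(1) u(1) EP(2)[OF gE] u(3)] .
      show "u \<preceq> f \<or> f \<preceq> u" if f: "f \<in> E" for f
      proof (cases "rk f \<le> s")
        case True
        then have "f \<preceq> g" using g_upper f by (simp add: C_def)
        then show ?thesis using idem_le_trans[OF EP(1)[OF f] g(1) u(1) _ u(3)] by blast
      next
        case False
        then have "h \<preceq> f" using h_lower f by simp
        then show ?thesis using idem_le_trans[OF u(1) h(1) EP(1)[OF f] u(4)] by blast
      qed
    qed
    \<comment> \<open>The rank of \<open>u\<close> is at most \<open>rk g + N * rk v\<close>. So
      \<open>u\<close> belongs to \<open>C\<close> and lies below \<open>g\<close>, although its
      image contains the non-zero \<open>v\<close>, which \<open>g\<close> kills.\<close>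
    moreover have "rk u \<le> s"
      using dim_set_add_le[OF gp U(1)] U(4) rk_v u(2) dim_pri[OF uc] dim_pri[OF gc] by (simp add: W_def)
    ultimately have "u \<preceq> g" using g_upper by (simp add: C_def)
    then have "pri u \<subseteq> pri g" using idem_le_iff[OF u(1) g(1)] uc gc by (simp add: pri_subset_iff)
    then have "v \<in> pri g" using W(3) U(2) u(2) by blast
    then have "g \<otimes> v = v" using g(1) mem_pri_idem by (auto simp: idem_def)
    then show False using gv v(2) by simp
  qed
  then show ?thesis using that[of E] EP chain by blast
qed

end

section \<open>Algebraic elements\<close>

context ring
begin

lemma ring_center_carrier: "ring_center R \<subseteq> carrier R"
  by (auto simp: ring_center_def)

lemma ring_center_comm: "z \<in> ring_center R \<Longrightarrow> a \<in> carrier R \<Longrightarrow> z \<otimes> a = a \<otimes> z"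
  by (simp add: ring_center_def)

section \<open>Invariant right ideals generated by one element\<close>

primrec krylov :: "'a \<Rightarrow> 'a \<Rightarrow> nat \<Rightarrow> 'a set" where
  "krylov x v 0 = {\<zero>}"
| "krylov x v (Suc n) = krylov x v n <+> pri (x [^] n \<otimes> v)"

text \<open>With \<open>v\<close> an idempotent or its complement, this evaluates a polynomial at
  \<open>c + be\<close> separately on the image and on the kernel of \<open>e\<close>.\<close>

lemma eval_mult_cong:
  assumes "set p \<subseteq> carrier R" "x \<in> carrier R" "y \<in> carrier R" "v \<in> carrier R"
    and "\<And>k::nat. x [^] k \<otimes> v = y [^] k \<otimes> v"
  shows "eval p x \<otimes> v = eval p y \<otimes> v"
  using assms(1)
proof (induction p)
  case (Cons a p)
  have "(a \<otimes> x [^] k) \<otimes> v = (a \<otimes> y [^] k) \<otimes> v" for k :: nat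
    using Cons.prems assms(2-5) by (simp add: m_assoc)
  then show ?case using Cons assms(2-4) by (simp add: l_distr eval_in_carrier)
qed simp

end

context regular_ring
begin

lemma krylov_in_pris: "x \<in> carrier R \<Longrightarrow> v \<in> carrier R \<Longrightarrow> krylov x v n \<in> pris"
  by (induction n) (auto simp: zero_in_pris intro: pris_set_add)

lemma krylov_Suc_subset:
  assumes "x \<in> carrier R" "v \<in> carrier R" shows "krylov x v n \<subseteq> krylov x v (Suc n)"
  using subset_set_add1[OF krylov_in_pris[OF assms]] assms by simp

lemma krylov_power:
  assumes "x \<in> carrier R" "v \<in> carrier R" "r \<in> carrier R"
  shows "x [^] n \<otimes> v \<otimes> r \<in> krylov x v (Suc n)"
  using subset_set_add2[OF krylov_in_pris[OF assms(1,2), of n], of "pri (x [^] n \<otimes> v)"] assms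
    pri_mult_mem[OF assms(3), of "x [^] n \<otimes> v"] by auto

lemma generator_mem_krylov:
  assumes "x \<in> carrier R" "v \<in> carrier R" shows "v \<in> krylov x v (Suc n)"
proof (induction n)
  case 0
  then show ?case using krylov_power[OF assms, of \<one> 0] assms by simp
next
  case (Suc n)
  then show ?case using krylov_Suc_subset[OF assms] by blast
qed

lemma krylov_shift:
  assumes "x \<in> carrier R" "v \<in> carrier R" "y \<in> krylov x v n" shows "x \<otimes> y \<in> krylov x v (Suc n)"
  using assms(3)
proof (induction n arbitrary: y)
  case 0
  then show ?case using assms pris_zero[OF krylov_in_pris[OF assms(1,2)], of "Suc 0"] by simp
next
  case (Suc n)
  then obtain a r where a: "a \<in> krylov x v n" "r \<in> carrier R" "y = a \<oplus> x [^] n \<otimes> v \<otimes> r"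
    by (auto simp: mem_set_add principal_right_ideal_def)
  have ac: "a \<in> carrier R" using a(1) krylov_in_pris[OF assms(1,2)] pris_mem_carrier by blast
  have "x \<otimes> y = x \<otimes> a \<oplus> x [^] Suc n \<otimes> v \<otimes> r"
    using assms(1,2) a(2,3) ac nat_pow_Suc2[of x n] by (simp add: r_distr m_assoc)
  moreover have "x \<otimes> a \<in> krylov x v (Suc (Suc n))"
    using Suc.IH[OF a(1)] krylov_Suc_subset[OF assms(1,2)] by blast
  ultimately show ?case
    using krylov_power[OF assms(1,2) a(2), of "Suc n"] pris_add krylov_in_pris[OF assms(1,2)] by metis
qed

lemma krylov_least:
  assumes "x \<in> carrier R" "v \<in> K" "K \<in> pris" "\<And>y. y \<in> K \<Longrightarrow> x \<otimes> y \<in> K"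
  shows "krylov x v n \<subseteq> K"
proof -
  have v: "v \<in> carrier R" using assms(2,3) pris_mem_carrier by blast
  have pow: "x [^] k \<otimes> v \<in> K" for k :: nat
  proof (induction k)
    case (Suc k)
    then show ?case using assms(1,4) v nat_pow_Suc2[of x k] by (auto simp: m_assoc)
  qed (use assms(2) v in simp)
  show ?thesis
  proof (induction n)
    case (Suc n)
    have "pri (x [^] n \<otimes> v) \<subseteq> K" using pow[of n] assms(1,3) v by (simp add: pri_subset_iff)
    then show ?case using Suc set_add_subset[OF assms(3)] by simp
  qed (use assms(3) pris_zero in simp)
qed

text \<open>Coefficients stand on the left, but a right ideal absorbs factors on the right;
  centrality moves them there. In \<open>a # p\<close> the head \<open>a\<close> belongs to the
  power \<open>length p\<close>.\<close>

lemma eval_mult_mem_krylov: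
  assumes "x \<in> carrier R" "v \<in> carrier R" "set p \<subseteq> ring_center R"
  shows "eval p x \<otimes> v \<in> krylov x v (length p)"
  using assms(3)
proof (induction p)
  case Nil
  then show ?case using assms by simp
next
  case (Cons a p)
  have a: "a \<in> ring_center R" "a \<in> carrier R" and p: "set p \<subseteq> carrier R"
    using Cons.prems ring_center_carrier by auto
  have "eval p x \<otimes> v \<in> krylov x v (Suc (length p))"
    using Cons krylov_Suc_subset[OF assms(1,2)] by auto
  moreover have "a \<otimes> x [^] length p \<otimes> v = x [^] length p \<otimes> v \<otimes> a"
    using ring_center_comm[OF a(1), of "x [^] length p \<otimes> v"] assms(1,2) a(2) by (simp add: m_assoc)
  then have "a \<otimes> x [^] length p \<otimes> v \<in> krylov x v (Suc (length p))"
    using krylov_power[OF assms(1,2) a(2)] by simp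
  ultimately have "a \<otimes> x [^] length p \<otimes> v \<oplus> eval p x \<otimes> v \<in> krylov x v (Suc (length p))"
    using pris_add[OF krylov_in_pris[OF assms(1,2)]] by blast
  then show ?case
    using assms(1,2) a(2) p by (simp add: l_distr eval_in_carrier del: krylov.simps)
qed

end

lemma (in ranked_ring) dim_krylov:
  assumes "x \<in> carrier R" "v \<in> carrier R" shows "dim (krylov x v n) \<le> real n * rk v"
proof (induction n)
  case (Suc n)
  have "dim (krylov x v (Suc n)) \<le> dim (krylov x v n) + rk (x [^] n \<otimes> v)"
    using dim_set_add_le[OF krylov_in_pris[OF assms], of "pri (x [^] n \<otimes> v)"] assms by (simp add: dim_pri)
  moreover have "rk (x [^] n \<otimes> v) \<le> rk v" using assms by (intro rk_mult) auto
  ultimately show ?case using Suc by (simp add: distrib_right)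
qed (simp add: dim_zero)

text \<open>The relation expresses \<open>a x^n v\<close> through lower powers, where
  \<open>n = length p\<close>, and the central element \<open>a\<close> is invertible. So the spans
  stop growing at the degree, which by \<open>krylov_shift\<close> makes the last one closed under
  \<open>x\<close>.\<close>

lemma (in nondiscrete_irreducible_ring) krylov_invariant:
  assumes x: "x \<in> carrier R" and p: "set (a # p) \<subseteq> ring_center R" "a \<noteq> \<zero>" "eval (a # p) x = \<zero>"
    and v: "v \<in> carrier R"
  shows "krylov x v (Suc (length p)) = krylov x v (length p)"
proof -
  let ?n = "length p"
  have a: "a \<in> ring_center R" "a \<in> carrier R" and pc: "set p \<subseteq> carrier R"
    using p(1) ring_center_carrier by auto
  obtain w where w: "w \<in> carrier R" "a \<otimes> w = \<one>" 
    using irreducible_imp_central_unit[OF irreducible a(1) p(2)] .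
  have K: "krylov x v ?n \<in> pris" by (rule krylov_in_pris[OF x v])
  have xn: "x [^] ?n \<otimes> v \<in> carrier R" using x v by simp
  have ev: "eval p x \<in> carrier R" using eval_in_carrier[OF pc x] .
  have "(a \<otimes> x [^] ?n \<oplus> eval p x) \<otimes> v = \<zero>" using p(3) v by simp
  then have "a \<otimes> (x [^] ?n \<otimes> v) \<oplus> eval p x \<otimes> v = \<zero>" using a x v ev by (simp add: l_distr m_assoc)
  then have "a \<otimes> (x [^] ?n \<otimes> v) = \<ominus> (eval p x \<otimes> v)" using a xn ev v by (simp add: minus_equality)
  also have "\<dots> \<in> krylov x v ?n" using eval_mult_mem_krylov[OF x v, of p] p(1) pris_neg[OF K] by simp
  finally have "a \<otimes> (x [^] ?n \<otimes> v) \<otimes> w \<in> krylov x v ?n" using pris_mult[OF K _ w(1)] by blast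
  moreover have "a \<otimes> (x [^] ?n \<otimes> v) \<otimes> w = x [^] ?n \<otimes> v"
    using ring_center_comm[OF a(1) xn] a(2) w xn by (simp add: m_assoc[of _ a w])
  ultimately have "pri (x [^] ?n \<otimes> v) \<subseteq> krylov x v ?n" using xn K by (simp add: pri_subset_iff)
  then have "krylov x v (Suc ?n) \<subseteq> krylov x v ?n" using set_add_subset[OF K subset_refl] by simp
  then show ?thesis using krylov_Suc_subset[OF x v] by blast
qed

section \<open>Geodesics\<close>

context nondiscrete_irreducible_ring
begin

lemma geodesic_from_central_zero:
  assumes S: "\<And>p. p \<in> S \<Longrightarrow> set p \<subseteq> ring_center R"
    and p: "a # p \<in> S" "a \<noteq> \<zero>"
    and c: "c \<in> poly_zeros R (ring_center R) S" and x: "x \<in> poly_zeros R (carrier R) S"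
  shows "\<exists>\<phi>. geodesic (poly_zeros R (carrier R) S) (rank_dist R rk) c x \<phi>"
proof -
  have cZ: "c \<in> ring_center R" and c0: "\<And>p. p \<in> S \<Longrightarrow> eval p c = \<zero>"
    using c by (auto simp: poly_zeros_def)
  have xc: "x \<in> carrier R" and x0: "\<And>p. p \<in> S \<Longrightarrow> eval p x = \<zero>"
    using x by (auto simp: poly_zeros_def)
  have cc: "c \<in> carrier R" using cZ ring_center_carrier by blast
  define b where "b = x \<ominus> c"
  have bc: "b \<in> carrier R" using xc cc by (simp add: b_def)
  have cb: "c \<oplus> b = x" using xc cc by (simp add: b_def minus_eq a_lcomm[of c] r_neg)
  obtain b' where b': "b' \<in> carrier R" "b \<otimes> b' \<otimes> b = b" using regular bc by blast
  \<comment> \<open>\<open>b\<close> and \<open>q\<close> are left multiples of each other, so they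
    have the same kernel and the same rank. From \<open>e0 = 1 - q\<close> up to \<open>1\<close>,
    the rank thus traverses an interval of length \<open>rk b\<close>, the distance from
    \<open>c\<close> to \<open>x\<close>.\<close>
  define q where "q = b' \<otimes> b"
  have q: "idem q" "q \<in> carrier R" "b \<otimes> q = b" 
    using b' bc by (auto simp: q_def idem_def m_assoc)
  define e0 where "e0 = \<one> \<ominus> q"
  have e0: "idem e0" "e0 \<in> carrier R" "\<one> \<ominus> e0 = q"
    using q by (auto simp: e0_def idem_one_minus one_minus_one_minus)
  have be0: "b \<otimes> e0 = \<zero>" using mult_one_minus_eq_zero[OF q(2) bc] q(3) by (simp add: e0_def)
  have rk_q: "rk q = rk b"
    using rk_mult(2)[OF b'(1) bc] rk_mult(2)[OF bc q(2)] q(3) by (simp add: q_def)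
  have rk_e0: "rk e0 = 1 - rk b" using rk_one_minus[OF q(1)] rk_q by (simp add: e0_def)
  \<comment> \<open>On the kernel of \<open>b\<close>, \<open>x\<close> acts as the central element
    \<open>c\<close>, so the image of \<open>e0\<close> is invariant.\<close>
  have "x \<otimes> e0 = c \<otimes> e0" using be0 e0(2) cc bc by (simp add: l_distr flip: cb)
  then have xe0: "x \<otimes> e0 = e0 \<otimes> c" using ring_center_comm[OF cZ e0(2)] by simp
  have "e0 \<otimes> (x \<otimes> e0) = x \<otimes> e0"
    using e0 cc by (simp add: xe0 idem_def flip: m_assoc)
  have cyclic: "\<exists>U\<in>pris. v \<in> U \<and> (\<forall>y\<in>U. x \<otimes> y \<in> U) \<and> dim U \<le> real (length p) * rk v \<and>
      (\<forall>K\<in>pris. v \<in> K \<longrightarrow> (\<forall>y\<in>K. x \<otimes> y \<in> K) \<longrightarrow> U \<subseteq> K)" if v: "v \<in> carrier R" for v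
  proof (intro bexI conjI ballI impI)
    let ?U = "krylov x v (length p)"
    have U: "krylov x v (Suc (length p)) = ?U" 
      by (rule krylov_invariant[OF xc S[OF p(1)] p(2) x0[OF p(1)] v])
    show "?U \<in> pris" by (rule krylov_in_pris[OF xc v])
    show "v \<in> ?U" using generator_mem_krylov[OF xc v] U by blast
    show "x \<otimes> y \<in> ?U" if "y \<in> ?U" for y using krylov_shift[OF xc v that] U by blast
    show "dim ?U \<le> real (length p) * rk v" by (rule dim_krylov[OF xc v])
    show "?U \<subseteq> K" if "K \<in> pris" "v \<in> K" "\<forall>y\<in>K. x \<otimes> y \<in> K" for K
      using that by (intro krylov_least[OF xc]) auto
  qed
  obtain E where E: "\<And>e. e \<in> E \<Longrightarrow> idem e \<and> e0 \<preceq> e \<and> e \<otimes> (x \<otimes> e) = x \<otimes> e"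
    and chain: "\<And>e f. e \<in> E \<Longrightarrow> f \<in> E \<Longrightarrow> e \<preceq> f \<or> f \<preceq> e"
    and ranks: "\<And>s. rk e0 \<le> s \<Longrightarrow> s \<le> 1 \<Longrightarrow> \<exists>e\<in>E. rk e = s"
    using invariant_idem_chain[OF xc e0(1) \<open>e0 \<otimes> (x \<otimes> e0) = x \<otimes> e0\<close> cyclic of_nat_0_le_iff] by blast
  have "\<forall>t\<in>{0..rk b}. \<exists>e\<in>E. rk e = rk e0 + t" using ranks rk_e0 by auto
  then obtain e where e: "\<And>t. t \<in> {0..rk b} \<Longrightarrow> e t \<in> E \<and> rk (e t) = rk e0 + t" by metis
  have et: "idem (e t)" "e0 \<preceq> e t" "e t \<otimes> (x \<otimes> e t) = x \<otimes> e t" "e t \<in> carrier R" "rk (e t) = rk e0 + t"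
    if "t \<in> {0..rk b}" for t
    using e[OF that] E[of "e t"] by (auto simp: idem_carrier)
  define \<phi> where "\<phi> = (\<lambda>t. c \<oplus> b \<otimes> e t)"
  have \<phi>c: "\<phi> t \<in> carrier R" if "t \<in> {0..rk b}" for t using et[OF that] cc bc by (simp add: \<phi>_def)
  have dist_cx: "rank_dist R rk c x = rk b"
  proof -
    have "c \<ominus> x = \<ominus> b" using xc cc by (simp add: b_def minus_eq minus_add a_comm)
    then show ?thesis using xc cc rk_neg[OF bc] by (simp add: rank_dist_def)
  qed
  have zeros: "\<phi> t \<in> poly_zeros R (carrier R) S" if t: "t \<in> {0..rk b}" for t
  proof -
    note et = et[OF t]
    have ee: "e t \<otimes> e t = e t" using et(1) by (simp add: idem_def)
    define f where "f = \<one> \<ominus> e t"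
    have f: "f \<in> carrier R" "e t \<otimes> f = \<zero>" "e t \<oplus> f = \<one>" 
      using et(4) idem_compl(2)[OF et(4) ee] by (auto simp: f_def minus_eq a_lcomm[of "e t"] r_neg)
    \<comment> \<open>On the image of \<open>e t\<close>, the element \<open>\<phi> t\<close> acts
      as \<open>x\<close>, and invariance of this image extends the agreement to powers. On the
      image of \<open>f\<close> it acts as \<open>c\<close>, where centrality takes the place of
      invariance.\<close>
    have "\<phi> t \<otimes> e t = x \<otimes> e t" 
      using et(4) ee bc cc by (simp add: \<phi>_def l_distr m_assoc flip: cb)
    then have pow_e: "\<phi> t [^] k \<otimes> e t = x [^] k \<otimes> e t" for k :: nat
    proof (induction k)
      case (Suc k)
      have "\<phi> t [^] Suc k \<otimes> e t = \<phi> t [^] k \<otimes> (e t \<otimes> (x \<otimes> e t))"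
        using Suc.prems et(3,4) \<phi>c[OF t] by (simp add: m_assoc)
      also have "\<dots> = \<phi> t [^] k \<otimes> e t \<otimes> (x \<otimes> e t)" using et(4) \<phi>c[OF t] xc by (simp add: m_assoc)
      also have "\<dots> = x [^] k \<otimes> (e t \<otimes> (x \<otimes> e t))" using Suc et(4) xc by (simp add: m_assoc)
      finally show ?case using et(3,4) xc by (simp add: m_assoc)
    qed (use et(4) in simp)
    have "\<phi> t \<otimes> f = c \<otimes> f" using et(4) f bc cc by (simp add: \<phi>_def l_distr m_assoc)
    then have pow_f: "\<phi> t [^] k \<otimes> f = c [^] k \<otimes> f" for k :: nat
    proof (induction k)
      case (Suc k)
      have "\<phi> t [^] Suc k \<otimes> f = \<phi> t [^] k \<otimes> (f \<otimes> c)"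
        using Suc.prems f(1) \<phi>c[OF t] ring_center_comm[OF cZ f(1)] by (simp add: m_assoc)
      also have "\<dots> = c [^] k \<otimes> (f \<otimes> c)" using Suc f(1) cc \<phi>c[OF t] by (simp flip: m_assoc)
      finally show ?case using ring_center_comm[OF cZ f(1)] f(1) cc by (simp add: m_assoc)
    qed (use f in simp)
    have "eval p (\<phi> t) = \<zero>" if pS: "p \<in> S" for p
    proof -
      have pc: "set p \<subseteq> carrier R" using S[OF pS] ring_center_carrier by blast
      have ev: "eval p (\<phi> t) \<in> carrier R" using eval_in_carrier[OF pc \<phi>c[OF t]] .
      have "eval p (\<phi> t) = eval p (\<phi> t) \<otimes> (e t \<oplus> f)" using ev f(3) by simp
      also have "\<dots> = eval p (\<phi> t) \<otimes> e t \<oplus> eval p (\<phi> t) \<otimes> f" using ev et(4) f(1) by (simp add: r_distr)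
      also have "\<dots> = eval p x \<otimes> e t \<oplus> eval p c \<otimes> f"
        using eval_mult_cong[OF pc \<phi>c[OF t] xc et(4) pow_e] eval_mult_cong[OF pc \<phi>c[OF t] cc f(1) pow_f] by simp
      finally show ?thesis using x0[OF pS] c0[OF pS] et(4) f(1) by simp
    qed
    then show ?thesis using \<phi>c[OF t] by (simp add: poly_zeros_def)
  qed
  have dist_le: "rank_dist R rk (\<phi> s) (\<phi> t) = t - s" if st: "s \<in> {0..rk b}" "t \<in> {0..rk b}" "s \<le> t" for s t
  proof -
    note es = et[OF st(1)] and et = et[OF st(2)]
    have le: "e s \<preceq> e t"
    proof (cases "e s \<preceq> e t")
      case False
      then have ts: "e t \<preceq> e s" using chain[of "e s" "e t"] e[OF st(1)] e[OF st(2)] by blast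
      have "rk (e s) \<le> rk (e t)" using es(5) et(5) st(3) by linarith
      then have "e t = e s" by (rule idem_le_rk_eq[OF et(1) es(1) ts])
      then show ?thesis using ts by simp
    qed
    define f where "f = e t \<ominus> e s"
    have fc: "f \<in> carrier R" using es(4) et(4) by (simp add: f_def)
    \<comment> \<open>This places \<open>f\<close> in \<open>qR\<close>, where \<open>b'\<close>
      undoes \<open>b\<close>; hence \<open>b\<close> does not lower the rank of
      \<open>f\<close>.\<close>
    have "e0 \<otimes> f = \<zero>"
      using es(2,4) et(2,4) e0(2) by (simp add: f_def minus_eq r_distr r_minus idem_le_def r_neg)
    then have "q \<otimes> f = f" using one_minus_mult_eq_zero[of q f] q(2) fc by (simp add: e0_def)
    then have "b' \<otimes> (b \<otimes> f) = f" using b' bc fc by (simp add: q_def m_assoc)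
    then have "rk (b \<otimes> f) = rk f" using rk_mult(2)[of b' "b \<otimes> f"] rk_mult(2)[OF bc fc] b' bc fc by simp
    moreover have "rk f = t - s" using rk_idem_diff[OF es(1) et(1) le] es(5) et(5) by (simp add: f_def)
    moreover have "\<phi> t \<ominus> \<phi> s = b \<otimes> f"
    proof -
      have "\<phi> t = b \<otimes> f \<oplus> \<phi> s"
        using es(4) et(4) bc cc 
        by (simp add: \<phi>_def f_def minus_eq r_distr r_minus a_assoc a_lcomm[of _ c] l_neg)
      then show ?thesis using \<phi>c[OF st(1)] bc fc diff_cancel(2) by simp
    qed
    ultimately have "rank_dist R rk (\<phi> t) (\<phi> s) = t - s" using \<phi>c st by (simp add: rank_dist_def)
    then show ?thesis using Metric_space.commute[OF Metric_space_rank_dist] by metis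
  qed
  have isometric: "rank_dist R rk (\<phi> s) (\<phi> t) = dist s t" if "s \<in> {0..rk b}" "t \<in> {0..rk b}" for s t
    using dist_le[OF that] dist_le[OF that(2,1)] Metric_space.commute[OF Metric_space_rank_dist, of "\<phi> s" "\<phi> t"]
    by (cases "s \<le> t") (auto simp: dist_real_def)
  \<comment> \<open>At both ends the rank determines the idempotent: only \<open>e0\<close> itself
    lies above \<open>e0\<close> with the same rank, and only \<open>\<one>\<close> has rank
    1.\<close>
  have b0: "0 \<in> {0..rk b}" "rk b \<in> {0..rk b}" using rk_range[OF bc] by auto
  have "e0 = e 0" using et[OF b0(1)] by (intro idem_le_rk_eq[OF e0(1)]) auto
  then have "\<phi> 0 = c" using be0 cc by (simp add: \<phi>_def)
  moreover have "e (rk b) = \<one>"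
    using et[OF b0(2)] rk_e0 by (intro idem_le_rk_eq) (auto simp: idem_def idem_le_def rk_one)
  then have "\<phi> (rk b) = x" using bc cb by (simp add: \<phi>_def)
  ultimately show ?thesis
    unfolding geodesic_def dist_cx using zeros isometric by blast
qed

end

theorem proposition5p6:
  fixes R :: "('a, 'b) ring_scheme" (structure)
    and rk :: "'a \<Rightarrow> real"
    and S :: "'a list set"
    and c :: 'a
  assumes "continuous_ring R"
    and "irreducible_ring R"
    and "rank_function R rk"
    and "rank_topology R rk \<noteq> discrete_topology (carrier R)"
    and "S \<subseteq> carrier ((ring_center R)[X])"
    and "S \<noteq> {}"
    and "S \<noteq> {\<zero>\<^bsub>(ring_center R)[X]\<^esub>}"
    and "c \<in> poly_zeros R (ring_center R) S"
  shows "star_shaped (poly_zeros R (carrier R) S) (rank_dist R rk) c"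
proof -
  interpret continuous_ring R by (rule assms(1))
  interpret nondiscrete_irreducible_ring R rk
    by unfold_locales (use assms in auto)
  have poly: "polynomial (ring_center R) p" if "p \<in> S" for p
    using that assms(5) univ_poly_carrier by blast
  \<comment> \<open>The zero polynomial is the empty list, so \<open>S\<close> contains a list with
    a head; this is its leading coefficient, which \<open>polynomial\<close> makes non-zero.\<close>
  obtain r where "r \<in> S" "r \<noteq> []" using assms(6,7) by (auto simp: univ_poly_zero)
  then obtain a p where r: "r = a # p" by (cases r) auto
  have p: "a # p \<in> S" "a \<noteq> \<zero>"
    using poly[OF \<open>r \<in> S\<close>] \<open>r \<in> S\<close> by (auto simp: polynomial_def r)
  have "Metric_space (poly_zeros R (carrier R) S) (rank_dist R rk)"
    using Metric_space.subspace[OF Metric_space_rank_dist] by (simp add: poly_zeros_def)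
  moreover have "c \<in> poly_zeros R (carrier R) S"
    using assms(8) ring_center_carrier by (auto simp: poly_zeros_def)
  moreover have "set p \<subseteq> ring_center R" if "p \<in> S" for p
    using poly[OF that] by (auto simp: polynomial_def)
  ultimately show ?thesis
    unfolding star_shaped_def using geodesic_from_central_zero[OF _ p assms(8)] by blast
qed

end
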